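(* Let $S_{\mathrm uk},I_{\mathrm uk},S_{\mathrm dk},I_{\mathrm dk}$ be the functions of $(\boldsymbol\theta_{\mathrm r},\boldsymbol\theta_{\mathrm t})$ $$S_{\mathrm uk}=p_{\mathrm uk}\mathrm{Tr}^2(\tilde{\boldsymbol\Psi}_k),$$ $$I_{\mathrm uk}=\mathrm{Tr}(\tilde{\boldsymbol\Psi}_k\tilde{\mathbf R}_{\mathrm{sum}})+\tfrac{p_{\mathrm b}}{\mathrm{Tr}(\boldsymbol\Psi_{\mathrm{sum}})}\mathrm{Tr}(\tilde{\boldsymbol\Psi}_k\tilde{\mathbf R}_{\mathrm b})\mathrm{Tr}(\mathbf R_{\mathrm b}\boldsymbol\Psi_{\mathrm{sum}})\{\delta_g\tilde\delta_g\mathrm{Tr}(\mathbf A_{\mathrm r}\boldsymbol\Theta_{\mathrm r}^{\mathsf H})+\sigma_{\mathrm L}^2\}-p_{\mathrm uk}\mathrm{Tr}(\tilde{\boldsymbol\Psi}_k^2)+\sigma_{\mathrm b}^2\mathrm{Tr}(\tilde{\boldsymbol\Psi}_k),$$ $$S_{\mathrm dk}=\mathrm{Tr}^2(\boldsymbol\Psi_k),$$ $$I_{\mathrm dk}=\mathrm{Tr}(\mathbf R_k\boldsymbol\Psi_{\mathrm{sum}})+\tfrac{\mathrm{Tr}(\boldsymbol\Psi_{\mathrm{sum}})}{p_{\mathrm b}}\sum_{j\in\mathcal K}p_{\mathrm uj}\{\sigma_{kj}^2+\delta_{h_k}\tilde\delta_{h_j}\mathrm{Tr}(\mathbf A_{w_k}\boldsymbol\Theta_{w_k}^{\mathsf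 H})\}-\mathrm{Tr}(\boldsymbol\Psi_k^2)+\tfrac{\sigma_{\mathrm d}^2}{p_{\mathrm b}}\mathrm{Tr}(\boldsymbol\Psi_{\mathrm{sum}}).$$ Then for every $k\in\mathcal K$, with $\mathbf a_{\mathrm m}=\mathrm{vec_d}(\mathbf A_{\mathrm m})$ for $\mathrm m\in\{\mathrm r,\mathrm t\}$, the gradients are: (1) $\nabla_{\boldsymbol\theta_{\mathrm r}}S_{\mathrm uk}=\tilde\nu_k\mathbf a_{\mathrm r}$ and $\nabla_{\boldsymbol\theta_{\mathrm t}}S_{\mathrm uk}=\mathbf 0$. (2) $\nabla_{\boldsymbol\theta_{\mathrm r}}S_{\mathrm dk}=\nu_k\mathbf a_{\mathrm r}$ if $w_k=\mathrm r$ and $\mathbf 0$ otherwise; $\nabla_{\boldsymbol\theta_{\mathrm t}}S_{\mathrm dk}=\nu_k\mathbf a_{\mathrm t}$ if $w_k=\mathrm t$ and $\mathbf 0$ otherwise. (3) $$\nabla_{\boldsymbol\theta_{\mathrm r}}I_{\mathrm uk}=\Big[\tilde\delta_g\tilde\delta_{h_k}\mathrm{Tr}\{\tilde{\mathbf R}_{\mathrm b}(\tilde{\mathbf B}_{k1}+\tilde{\mathbf B}_{k2}-\tilde{\mathbf B}_{k3}+\sigma_{\mathrm b}^2\tilde{\mathbf C}_k)\}+\tilde\delta_g\Big(\sum_{j\in\mathcal K}\tilde\delta_{h_j}p_{\mathrm uj}\Big)\mathrm{Tr}\{\tilde{\mathbf R}_{\mathrm b}\tilde{\boldsymbol\Psi}_k\}+\delta_g\sum_{i\in\mathcal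 K_{\mathrm r}}\delta_{h_i}\mathrm{Tr}\{\mathbf R_{\mathrm b}\tilde{\mathbf L}_{ki}\}+\tilde\chi_k\Big]\mathbf a_{\mathrm r},$$ $$\nabla_{\boldsymbol\theta_{\mathrm t}}I_{\mathrm uk}=\Big[\delta_g\sum_{i\in\mathcal K_{\mathrm t}}\delta_{h_i}\mathrm{Tr}\{\mathbf R_{\mathrm b}\tilde{\mathbf L}_{ki}\}\Big]\mathbf a_{\mathrm t}.$$ (4) If $w_k=\mathrm r$, $$\nabla_{\boldsymbol\theta_{\mathrm r}}I_{\mathrm dk}=\Big[\delta_g\delta_{h_k}\mathrm{Tr}\{\mathbf R_{\mathrm b}(\boldsymbol\Psi_{\mathrm{sum}}-\mathbf B_k)\}+\delta_g\sum_{i\in\mathcal K_{\mathrm r}}\delta_{h_i}\mathrm{Tr}\{\mathbf R_{\mathrm b}(\mathbf L_{ki}+\chi_{k1}\mathbf C_i)\}+\chi_{k2}\Big]\mathbf a_{\mathrm r},$$ $$\nabla_{\boldsymbol\theta_{\mathrm t}}I_{\mathrm dk}=\Big[\delta_g\sum_{i\in\mathcal K_{\mathrm t}}\delta_{h_i}\mathrm{Tr}\{\mathbf R_{\mathrm b}(\mathbf L_{ki}+\chi_{k1}\mathbf C_i)\}\Big]\mathbf a_{\mathrm t};$$ if $w_k=\mathrm t$, $$\nabla_{\boldsymbol\theta_{\mathrm r}}I_{\mathrm dk}=\Big[\delta_g\sum_{i\in\mathcal K_{\mathrm r}}\delta_{h_i}\mathrm{Tr}\{\mathbf R_{\mathrm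 b}(\mathbf L_{ki}+\chi_{k1}\mathbf C_i)\}\Big]\mathbf a_{\mathrm r},$$ $$\nabla_{\boldsymbol\theta_{\mathrm t}}I_{\mathrm dk}=\Big[\delta_g\delta_{h_k}\mathrm{Tr}\{\mathbf R_{\mathrm b}(\boldsymbol\Psi_{\mathrm{sum}}-\mathbf B_k)\}+\delta_g\sum_{i\in\mathcal K_{\mathrm t}}\delta_{h_i}\mathrm{Tr}\{\mathbf R_{\mathrm b}(\mathbf L_{ki}+\chi_{k1}\mathbf C_i)\}+\chi_{k2}\Big]\mathbf a_{\mathrm t}.$$ Here $\tilde\nu_k=2\tilde\delta_g\tilde\delta_{h_k}p_{\mathrm uk}\mathrm{Tr}(\tilde{\boldsymbol\Psi}_k)\mathrm{Tr}(\tilde{\mathbf R}_{\mathrm b}\tilde{\mathbf C}_k)$, $\tilde{\mathbf C}_k=\tilde{\mathbf Q}_k\tilde{\mathbf R}_k-\tilde{\mathbf Q}_k\tilde{\mathbf R}_k^2\tilde{\mathbf Q}_k+\tilde{\mathbf R}_k\tilde{\mathbf Q}_k$, $\nu_k=2\delta_g\delta_{h_k}\mathrm{Tr}(\boldsymbol\Psi_k)\mathrm{Tr}(\mathbf R_{\mathrm b}\mathbf C_k)$, $\mathbf C_k=\mathbf Q_k\mathbf R_k-\mathbf Q_k\mathbf R_k^2\mathbf Q_k+\mathbf R_k\mathbf Q_k$, $\tilde{\mathbf B}_{k1}=\tilde{\mathbf Q}_k\tilde{\mathbf R}_k\tilde{\mathbf R}_{\mathrm{sum}}-\tilde{\mathbf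 Q}_k\tilde{\mathbf R}_k\tilde{\mathbf R}_{\mathrm{sum}}\tilde{\mathbf R}_k\tilde{\mathbf Q}_k+\tilde{\mathbf R}_{\mathrm{sum}}\tilde{\mathbf R}_k\tilde{\mathbf Q}_k$, $\varpi=\frac{p_{\mathrm b}}{\mathrm{Tr}(\boldsymbol\Psi_{\mathrm{sum}})}\mathrm{Tr}(\mathbf R_{\mathrm b}\boldsymbol\Psi_{\mathrm{sum}})\{\delta_g\tilde\delta_g\mathrm{Tr}(\mathbf A_{\mathrm r}\boldsymbol\Theta_{\mathrm r}^{\mathsf H})+\sigma_{\mathrm L}^2\}$, $\tilde{\boldsymbol\Xi}_k=\frac{p_{\mathrm b}}{\mathrm{Tr}(\boldsymbol\Psi_{\mathrm{sum}})}\mathrm{Tr}(\tilde{\boldsymbol\Psi}_k\tilde{\mathbf R}_{\mathrm b})\{\delta_g\tilde\delta_g\mathrm{Tr}(\mathbf A_{\mathrm r}\boldsymbol\Theta_{\mathrm r}^{\mathsf H})+\sigma_{\mathrm L}^2\}\Big[\mathbf R_{\mathrm b}-\frac{\mathrm{Tr}(\mathbf R_{\mathrm b}\boldsymbol\Psi_{\mathrm{sum}})}{\mathrm{Tr}(\boldsymbol\Psi_{\mathrm{sum}})}\mathbf I_{M_{\mathrm T}}\Big]$, $\tilde\chi_k=\frac{p_{\mathrm b}\delta_g\tilde\delta_g}{\mathrm{Tr}(\boldsymbol\Psi_{\mathrm{sum}})}\mathrm{Tr}(\tilde{\boldsymbol\Psi}_k\tilde{\mathbf R}_{\mathrm b})\mathrm{Tr}(\mathbf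 R_{\mathrm b}\boldsymbol\Psi_{\mathrm{sum}})$, $\tilde{\mathbf B}_{k2}=\varpi(\tilde{\mathbf Q}_k\tilde{\mathbf R}_k\tilde{\mathbf R}_{\mathrm b}-\tilde{\mathbf Q}_k\tilde{\mathbf R}_k\tilde{\mathbf R}_{\mathrm b}\tilde{\mathbf R}_k\tilde{\mathbf Q}_k+\tilde{\mathbf R}_{\mathrm b}\tilde{\mathbf R}_k\tilde{\mathbf Q}_k)$, $\tilde{\mathbf L}_{kj}=\mathbf Q_j\mathbf R_j\tilde{\boldsymbol\Xi}_k-\mathbf Q_j\mathbf R_j\tilde{\boldsymbol\Xi}_k\mathbf R_j\mathbf Q_j+\tilde{\boldsymbol\Xi}_k\mathbf R_j\mathbf Q_j$, $\tilde{\mathbf B}_{k3}=2p_{\mathrm uk}(\tilde{\mathbf Q}_k\tilde{\mathbf R}_k\tilde{\boldsymbol\Psi}_k-\tilde{\mathbf Q}_k\tilde{\mathbf R}_k\tilde{\boldsymbol\Psi}_k\tilde{\mathbf R}_k\tilde{\mathbf Q}_k+\tilde{\boldsymbol\Psi}_k\tilde{\mathbf R}_k\tilde{\mathbf Q}_k)$, $\mathbf L_{kj}=\mathbf Q_j\mathbf R_j\mathbf R_k-\mathbf Q_j\mathbf R_j\mathbf R_k\mathbf R_j\mathbf Q_j+\mathbf R_k\mathbf R_j\mathbf Q_j$, $\mathbf B_k=2(\mathbf Q_k\mathbf R_k\boldsymbol\Psi_k-\mathbf Q_k\mathbf R_k\boldsymbol\Psi_k\mathbf R_k\mathbf Q_k+\boldsymbol\Psi_k\mathbf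 R_k\mathbf Q_k)$, $\chi_{k1}=\frac1{p_{\mathrm b}}\sum_{j\in\mathcal K}p_{\mathrm uj}\{\sigma_{kj}^2+\delta_{h_k}\tilde\delta_{h_j}\mathrm{Tr}(\mathbf A_{w_k}\boldsymbol\Theta_{w_k}^{\mathsf H})\}+\frac{\sigma_{\mathrm d}^2}{p_{\mathrm b}}$, $\chi_{k2}=\frac{\delta_{h_k}}{p_{\mathrm b}}\mathrm{Tr}(\boldsymbol\Psi_{\mathrm{sum}})\sum_{j\in\mathcal K}p_{\mathrm uj}\tilde\delta_{h_j}$.
   Context: Notation: $(\cdot)^{\mathsf H}$ is conjugate transpose, $\mathrm{Tr}$ is trace, $\mathrm{Tr}^2(\mathbf X)=(\mathrm{Tr}\,\mathbf X)^2$; $\mathrm{diag}(\mathbf x)$ is the diagonal matrix with diagonal $\mathbf x$; $\mathrm{vec_d}(\mathbf X)$ is the column vector of diagonal entries of $\mathbf X$. For a function $f$ of $\boldsymbol\theta_{\mathrm m}\in\mathbb C^N$, $\nabla_{\boldsymbol\theta_{\mathrm m}}f$ denotes the complex (Wirtinger) gradient with respect to the conjugate, i.e. the column vector with entries $\partial f/\partial\theta_{\mathrm m,n}^*=\frac12(\partial f/\partial\,\mathrm{Re}\,\theta_{\mathrm m,n}+j\,\partial f/\partial\,\mathrm{Im}\,\theta_{\mathrm m,n})$, where $j$ is the imaginary unit. Setting: $\mathcal K=\{1,\dots,K\}=\mathcal K_{\mathrm r}\sqcup\mathcal K_{\mathrm t}$; $w_k=\mathrm r$ if $k\in\mathcal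 K_{\mathrm r}$ and $w_k=\mathrm t$ if $k\in\mathcal K_{\mathrm t}$. The variables are $\boldsymbol\theta_{\mathrm r},\boldsymbol\theta_{\mathrm t}\in\mathbb C^N$, with $\boldsymbol\theta_{\mathrm m}=[\theta_{\mathrm m,1},\dots,\theta_{\mathrm m,N}]^{\mathsf T}$ and $\boldsymbol\Theta_{\mathrm m}=\mathrm{diag}(\boldsymbol\theta_{\mathrm m})$, treated as free complex variables for differentiation. $\mathbf R_{\mathrm b}\in\mathbb C^{M_{\mathrm T}\times M_{\mathrm T}}$, $\tilde{\mathbf R}_{\mathrm b}\in\mathbb C^{M_{\mathrm R}\times M_{\mathrm R}}$, $\mathbf R_{\mathrm s}\in\mathbb C^{N\times N}$ are fixed Hermitian positive semidefinite matrices. The scalars $\delta_g,\tilde\delta_g,\delta_{h_k},\tilde\delta_{h_k}$ (path losses), $p_{\mathrm b}$, $p_{\mathrm uk}$ and $p_{\mathrm{Train}}$ (powers), $\tau_{\mathrm{up}},\tau_{\mathrm{dp}}$ (pilot lengths), $\sigma_{\mathrm u}^2,\sigma_{\mathrm b}^2,\sigma_{\mathrm d}^2$ (noise variances) are fixed and positive; $\sigma_{\mathrm dk}^2=\sigma_{\mathrm d}^2$ for all $k$; $\sigma_{\mathrm L}^2,\sigma_{kj}^2\ge0$ are fixed. Definitions: $\mathbf A_{\mathrm m}=\mathbf R_{\mathrm s}\boldsymbol\Theta_{\mathrm m}\mathbf R_{\mathrm s}$; $\tilde{\mathbf R}_k=\tilde\delta_g\tilde\delta_{h_k}\mathrm{Tr}(\mathbf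 A_{\mathrm r}\boldsymbol\Theta_{\mathrm r}^{\mathsf H})\tilde{\mathbf R}_{\mathrm b}$; $\mathbf R_k=\delta_g\delta_{h_k}\mathrm{Tr}(\mathbf A_{w_k}\boldsymbol\Theta_{w_k}^{\mathsf H})\mathbf R_{\mathrm b}$; $\tilde{\mathbf Q}_k=(\tilde{\mathbf R}_k+\frac{\sigma_{\mathrm u}^2}{\tau_{\mathrm{up}}p_{\mathrm{Train}}}\mathbf I_{M_{\mathrm R}})^{-1}$; $\mathbf Q_k=(\mathbf R_k+\frac{\sigma_{\mathrm dk}^2}{\tau_{\mathrm{dp}}p_{\mathrm{Train}}}\mathbf I_{M_{\mathrm T}})^{-1}$; $\tilde{\boldsymbol\Psi}_k=\tilde{\mathbf R}_k\tilde{\mathbf Q}_k\tilde{\mathbf R}_k$; $\boldsymbol\Psi_k=\mathbf R_k\mathbf Q_k\mathbf R_k$; $\tilde{\mathbf R}_{\mathrm{sum}}=\sum_{j\in\mathcal K}p_{\mathrm uj}\tilde{\mathbf R}_j$; $\boldsymbol\Psi_{\mathrm{sum}}=\sum_{j\in\mathcal K}\boldsymbol\Psi_j$. Gradients are taken at points where $\mathrm{Tr}(\boldsymbol\Psi_{\mathrm{sum}})\ne0$. *)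

theory Defs
  imports "HOL-Analysis.Analysis"
begin

definition mscale :: "complex \<Rightarrow> complex^'m^'n \<Rightarrow> complex^'m^'n"  (infixr \<open>*\<^sub>M\<close> 75) where
  "c *\<^sub>M A = (\<chi> i j. c * A $ i $ j)"

definition ctranspose :: "complex^'m^'n \<Rightarrow> complex^'n^'m" where
  "ctranspose A = (\<chi> i j. cnj (A $ j $ i))"

definition diag :: "complex^'n \<Rightarrow> complex^'n^'n" where
  "diag x = (\<chi> i j. if i = j then x $ i else 0)"

definition vecd :: "complex^'n^'n \<Rightarrow> complex^'n" where
  "vecd A = (\<chi> i. A $ i $ i)"

definition hermitian_psd :: "complex^'n^'n \<Rightarrow> bool" where
  "hermitian_psd A \<longleftrightarrow> ctranspose A = A \<and>
     (\<forall>x. 0 \<le> Re (\<Sum>i\<in>UNIV. \<Sum>j\<in>UNIV. cnj (x $ i) * A $ i $ j * x $ j))"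

text \<open>Wirtinger gradient with respect to the conjugate variable. Existence of the real partial
  derivatives \<open>dx\<close>, \<open>dy\<close> is part of the predicate, so \<open>g\<close> is determined by \<open>f\<close> and \<open>z\<close>.\<close>

definition has_conj_gradient ::
    "(complex^'n \<Rightarrow> complex) \<Rightarrow> complex^'n \<Rightarrow> complex^'n \<Rightarrow> bool"
    (infix \<open>has'_conj'_gradient\<close> 50) where
  "(f has_conj_gradient g) z \<longleftrightarrow>
     (\<forall>n. \<exists>dx dy.
        ((\<lambda>s::real. f (z + axis n (complex_of_real s))) has_vector_derivative dx) (at 0) \<and>
        ((\<lambda>s::real. f (z + axis n (\<i> * complex_of_real s))) has_vector_derivative dy) (at 0) \<and>
        g $ n = (dx + \<i> * dy) / 2)"

datatype side = Rside | Tside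

text \<open>The suffix \<open>_til\<close> stands for a tilde. The \<open>var_\<close> fields are the noise variances, i.e. they hold
  the squared quantities: \<open>var_si p k j\<close> is \<open>\<sigma>\<^sub>k\<^sub>j\<^sup>2\<close> and \<open>var_L\<close> is \<open>\<sigma>\<^sub>L\<^sup>2\<close>. The index types
  \<open>'t\<close>, \<open>'r\<close>, \<open>'n\<close> have \<open>M\<^sub>T\<close>, \<open>M\<^sub>R\<close> and \<open>N\<close> elements.\<close>

record ('t, 'r, 'n) params =
  num_users :: nat
  Kr :: "nat set"
  Kt :: "nat set"
  Rb :: "complex^'t^'t"
  Rb_til :: "complex^'r^'r"
  Rs :: "complex^'n^'n"
  dg :: real
  dg_til :: real
  dh :: "nat \<Rightarrow> real"
  dh_til :: "nat \<Rightarrow> real"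
  pb :: real
  pu :: "nat \<Rightarrow> real"
  ptrain :: real
  tau_up :: real
  tau_dp :: real
  var_u :: real
  var_b :: real
  var_d :: real
  var_dk :: "nat \<Rightarrow> real"
  var_L :: real
  var_si :: "nat \<Rightarrow> nat \<Rightarrow> real"

definition users :: "('t::finite, 'r::finite, 'n::finite) params \<Rightarrow> nat set" where
  "users p = {1..num_users p}"

definition valid_params :: "('t::finite, 'r::finite, 'n::finite) params \<Rightarrow> bool" where
  "valid_params p \<longleftrightarrow>
     users p = Kr p \<union> Kt p \<and> Kr p \<inter> Kt p = {} \<and>
     hermitian_psd (Rb p) \<and> hermitian_psd (Rb_til p) \<and> hermitian_psd (Rs p) \<and>
     dg p > 0 \<and> dg_til p > 0 \<and> (\<forall>k\<in>users p. dh p k > 0 \<and> dh_til p k > 0) \<and>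
     pb p > 0 \<and> (\<forall>k\<in>users p. pu p k > 0) \<and> ptrain p > 0 \<and>
     tau_up p > 0 \<and> tau_dp p > 0 \<and>
     var_u p > 0 \<and> var_b p > 0 \<and> var_d p > 0 \<and> (\<forall>k\<in>users p. var_dk p k = var_d p) \<and>
     var_L p \<ge> 0 \<and> (\<forall>k\<in>users p. \<forall>j\<in>users p. var_si p k j \<ge> 0)"

definition side_of :: "('t::finite, 'r::finite, 'n::finite) params \<Rightarrow> nat \<Rightarrow> side" where
  "side_of p k = (if k \<in> Kr p then Rside else Tside)"

text \<open>The pair of variables \<open>\<theta>\<^sub>r\<close>, \<open>\<theta>\<^sub>t\<close> is the function \<open>\<theta>\<close> with values \<open>\<theta> Rside\<close>, \<open>\<theta> Tside\<close>.\<close>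

definition Amat :: "('t::finite, 'r::finite, 'n::finite) params \<Rightarrow> (side \<Rightarrow> complex^'n) \<Rightarrow> side \<Rightarrow> complex^'n^'n" where
  "Amat p \<theta> m = Rs p ** diag (\<theta> m) ** Rs p"

definition trA :: "('t::finite, 'r::finite, 'n::finite) params \<Rightarrow> (side \<Rightarrow> complex^'n) \<Rightarrow> side \<Rightarrow> complex" where
  "trA p \<theta> m = trace (Amat p \<theta> m ** ctranspose (diag (\<theta> m)))"

definition R_til :: "('t::finite, 'r::finite, 'n::finite) params \<Rightarrow> (side \<Rightarrow> complex^'n) \<Rightarrow> nat \<Rightarrow> complex^'r^'r" where
  "R_til p \<theta> k = (dg_til p * dh_til p k * trA p \<theta> Rside) *\<^sub>M Rb_til p"

definition Rmat :: "('t::finite, 'r::finite, 'n::finite) params \<Rightarrow> (side \<Rightarrow> complex^'n) \<Rightarrow> nat \<Rightarrow> complex^'t^'t" where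
  "Rmat p \<theta> k = (dg p * dh p k * trA p \<theta> (side_of p k)) *\<^sub>M Rb p"

definition Q_til :: "('t::finite, 'r::finite, 'n::finite) params \<Rightarrow> (side \<Rightarrow> complex^'n) \<Rightarrow> nat \<Rightarrow> complex^'r^'r" where
  "Q_til p \<theta> k = matrix_inv (R_til p \<theta> k + (var_u p / (tau_up p * ptrain p)) *\<^sub>M mat 1)"

definition Qmat :: "('t::finite, 'r::finite, 'n::finite) params \<Rightarrow> (side \<Rightarrow> complex^'n) \<Rightarrow> nat \<Rightarrow> complex^'t^'t" where
  "Qmat p \<theta> k = matrix_inv (Rmat p \<theta> k + (var_dk p k / (tau_dp p * ptrain p)) *\<^sub>M mat 1)"

definition Psi_til :: "('t::finite, 'r::finite, 'n::finite) params \<Rightarrow> (side \<Rightarrow> complex^'n) \<Rightarrow> nat \<Rightarrow> complex^'r^'r" where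
  "Psi_til p \<theta> k = R_til p \<theta> k ** Q_til p \<theta> k ** R_til p \<theta> k"

definition Psi :: "('t::finite, 'r::finite, 'n::finite) params \<Rightarrow> (side \<Rightarrow> complex^'n) \<Rightarrow> nat \<Rightarrow> complex^'t^'t" where
  "Psi p \<theta> k = Rmat p \<theta> k ** Qmat p \<theta> k ** Rmat p \<theta> k"

definition R_til_sum :: "('t::finite, 'r::finite, 'n::finite) params \<Rightarrow> (side \<Rightarrow> complex^'n) \<Rightarrow> complex^'r^'r" where
  "R_til_sum p \<theta> = (\<Sum>j\<in>users p. pu p j *\<^sub>M R_til p \<theta> j)"

definition Psi_sum :: "('t::finite, 'r::finite, 'n::finite) params \<Rightarrow> (side \<Rightarrow> complex^'n) \<Rightarrow> complex^'t^'t" where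
  "Psi_sum p \<theta> = (\<Sum>j\<in>users p. Psi p \<theta> j)"

definition S_u :: "('t::finite, 'r::finite, 'n::finite) params \<Rightarrow> nat \<Rightarrow> (side \<Rightarrow> complex^'n) \<Rightarrow> complex" where
  "S_u p k \<theta> = pu p k * (trace (Psi_til p \<theta> k))\<^sup>2"

definition I_u :: "('t::finite, 'r::finite, 'n::finite) params \<Rightarrow> nat \<Rightarrow> (side \<Rightarrow> complex^'n) \<Rightarrow> complex" where
  "I_u p k \<theta> =
     trace (Psi_til p \<theta> k ** R_til_sum p \<theta>)
     + pb p / trace (Psi_sum p \<theta>) * trace (Psi_til p \<theta> k ** Rb_til p) * trace (Rb p ** Psi_sum p \<theta>)
       * (dg p * dg_til p * trA p \<theta> Rside + var_L p)
     - pu p k * trace (Psi_til p \<theta> k ** Psi_til p \<theta> k)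
     + var_b p * trace (Psi_til p \<theta> k)"

definition S_d :: "('t::finite, 'r::finite, 'n::finite) params \<Rightarrow> nat \<Rightarrow> (side \<Rightarrow> complex^'n) \<Rightarrow> complex" where
  "S_d p k \<theta> = (trace (Psi p \<theta> k))\<^sup>2"

definition I_d :: "('t::finite, 'r::finite, 'n::finite) params \<Rightarrow> nat \<Rightarrow> (side \<Rightarrow> complex^'n) \<Rightarrow> complex" where
  "I_d p k \<theta> =
     trace (Rmat p \<theta> k ** Psi_sum p \<theta>)
     + trace (Psi_sum p \<theta>) / pb p *
       (\<Sum>j\<in>users p. pu p j * (var_si p k j + dh p k * dh_til p j * trA p \<theta> (side_of p k)))
     - trace (Psi p \<theta> k ** Psi p \<theta> k)
     + var_d p / pb p * trace (Psi_sum p \<theta>)"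

definition avec :: "('t::finite, 'r::finite, 'n::finite) params \<Rightarrow> (side \<Rightarrow> complex^'n) \<Rightarrow> side \<Rightarrow> complex^'n" where
  "avec p \<theta> m = vecd (Amat p \<theta> m)"

definition C_til :: "('t::finite, 'r::finite, 'n::finite) params \<Rightarrow> (side \<Rightarrow> complex^'n) \<Rightarrow> nat \<Rightarrow> complex^'r^'r" where
  "C_til p \<theta> k =
     Q_til p \<theta> k ** R_til p \<theta> k
     - Q_til p \<theta> k ** (R_til p \<theta> k ** R_til p \<theta> k) ** Q_til p \<theta> k
     + R_til p \<theta> k ** Q_til p \<theta> k"

definition Cmat :: "('t::finite, 'r::finite, 'n::finite) params \<Rightarrow> (side \<Rightarrow> complex^'n) \<Rightarrow> nat \<Rightarrow> complex^'t^'t" where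
  "Cmat p \<theta> k =
     Qmat p \<theta> k ** Rmat p \<theta> k
     - Qmat p \<theta> k ** (Rmat p \<theta> k ** Rmat p \<theta> k) ** Qmat p \<theta> k
     + Rmat p \<theta> k ** Qmat p \<theta> k"

definition nu_til :: "('t::finite, 'r::finite, 'n::finite) params \<Rightarrow> (side \<Rightarrow> complex^'n) \<Rightarrow> nat \<Rightarrow> complex" where
  "nu_til p \<theta> k =
     2 * dg_til p * dh_til p k * pu p k * trace (Psi_til p \<theta> k) * trace (Rb_til p ** C_til p \<theta> k)"

definition nu :: "('t::finite, 'r::finite, 'n::finite) params \<Rightarrow> (side \<Rightarrow> complex^'n) \<Rightarrow> nat \<Rightarrow> complex" where
  "nu p \<theta> k = 2 * dg p * dh p k * trace (Psi p \<theta> k) * trace (Rb p ** Cmat p \<theta> k)"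

definition varpi :: "('t::finite, 'r::finite, 'n::finite) params \<Rightarrow> (side \<Rightarrow> complex^'n) \<Rightarrow> complex" where
  "varpi p \<theta> =
     pb p / trace (Psi_sum p \<theta>) * trace (Rb p ** Psi_sum p \<theta>)
     * (dg p * dg_til p * trA p \<theta> Rside + var_L p)"

definition Xi_til :: "('t::finite, 'r::finite, 'n::finite) params \<Rightarrow> (side \<Rightarrow> complex^'n) \<Rightarrow> nat \<Rightarrow> complex^'t^'t" where
  "Xi_til p \<theta> k =
     (pb p / trace (Psi_sum p \<theta>) * trace (Psi_til p \<theta> k ** Rb_til p)
      * (dg p * dg_til p * trA p \<theta> Rside + var_L p)) *\<^sub>M
     (Rb p - (trace (Rb p ** Psi_sum p \<theta>) / trace (Psi_sum p \<theta>)) *\<^sub>M mat 1)"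

definition chi_til :: "('t::finite, 'r::finite, 'n::finite) params \<Rightarrow> (side \<Rightarrow> complex^'n) \<Rightarrow> nat \<Rightarrow> complex" where
  "chi_til p \<theta> k =
     pb p * dg p * dg_til p / trace (Psi_sum p \<theta>)
     * trace (Psi_til p \<theta> k ** Rb_til p) * trace (Rb p ** Psi_sum p \<theta>)"

definition B1_til :: "('t::finite, 'r::finite, 'n::finite) params \<Rightarrow> (side \<Rightarrow> complex^'n) \<Rightarrow> nat \<Rightarrow> complex^'r^'r" where
  "B1_til p \<theta> k =
     Q_til p \<theta> k ** R_til p \<theta> k ** R_til_sum p \<theta>
     - Q_til p \<theta> k ** R_til p \<theta> k ** R_til_sum p \<theta> ** R_til p \<theta> k ** Q_til p \<theta> k
     + R_til_sum p \<theta> ** R_til p \<theta> k ** Q_til p \<theta> k"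

definition B2_til :: "('t::finite, 'r::finite, 'n::finite) params \<Rightarrow> (side \<Rightarrow> complex^'n) \<Rightarrow> nat \<Rightarrow> complex^'r^'r" where
  "B2_til p \<theta> k = varpi p \<theta> *\<^sub>M
     (Q_til p \<theta> k ** R_til p \<theta> k ** Rb_til p
      - Q_til p \<theta> k ** R_til p \<theta> k ** Rb_til p ** R_til p \<theta> k ** Q_til p \<theta> k
      + Rb_til p ** R_til p \<theta> k ** Q_til p \<theta> k)"

definition B3_til :: "('t::finite, 'r::finite, 'n::finite) params \<Rightarrow> (side \<Rightarrow> complex^'n) \<Rightarrow> nat \<Rightarrow> complex^'r^'r" where
  "B3_til p \<theta> k = (2 * pu p k) *\<^sub>M
     (Q_til p \<theta> k ** R_til p \<theta> k ** Psi_til p \<theta> k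
      - Q_til p \<theta> k ** R_til p \<theta> k ** Psi_til p \<theta> k ** R_til p \<theta> k ** Q_til p \<theta> k
      + Psi_til p \<theta> k ** R_til p \<theta> k ** Q_til p \<theta> k)"

definition L_til :: "('t::finite, 'r::finite, 'n::finite) params \<Rightarrow> (side \<Rightarrow> complex^'n) \<Rightarrow> nat \<Rightarrow> nat \<Rightarrow> complex^'t^'t" where
  "L_til p \<theta> k j =
     Qmat p \<theta> j ** Rmat p \<theta> j ** Xi_til p \<theta> k
     - Qmat p \<theta> j ** Rmat p \<theta> j ** Xi_til p \<theta> k ** Rmat p \<theta> j ** Qmat p \<theta> j
     + Xi_til p \<theta> k ** Rmat p \<theta> j ** Qmat p \<theta> j"

definition Lmat :: "('t::finite, 'r::finite, 'n::finite) params \<Rightarrow> (side \<Rightarrow> complex^'n) \<Rightarrow> nat \<Rightarrow> nat \<Rightarrow> complex^'t^'t" where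
  "Lmat p \<theta> k j =
     Qmat p \<theta> j ** Rmat p \<theta> j ** Rmat p \<theta> k
     - Qmat p \<theta> j ** Rmat p \<theta> j ** Rmat p \<theta> k ** Rmat p \<theta> j ** Qmat p \<theta> j
     + Rmat p \<theta> k ** Rmat p \<theta> j ** Qmat p \<theta> j"

definition Bmat :: "('t::finite, 'r::finite, 'n::finite) params \<Rightarrow> (side \<Rightarrow> complex^'n) \<Rightarrow> nat \<Rightarrow> complex^'t^'t" where
  "Bmat p \<theta> k = 2 *\<^sub>M
     (Qmat p \<theta> k ** Rmat p \<theta> k ** Psi p \<theta> k
      - Qmat p \<theta> k ** Rmat p \<theta> k ** Psi p \<theta> k ** Rmat p \<theta> k ** Qmat p \<theta> k
      + Psi p \<theta> k ** Rmat p \<theta> k ** Qmat p \<theta> k)"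

definition chi1 :: "('t::finite, 'r::finite, 'n::finite) params \<Rightarrow> (side \<Rightarrow> complex^'n) \<Rightarrow> nat \<Rightarrow> complex" where
  "chi1 p \<theta> k =
     1 / pb p *
       (\<Sum>j\<in>users p. pu p j * (var_si p k j + dh p k * dh_til p j * trA p \<theta> (side_of p k)))
     + var_d p / pb p"

definition chi2 :: "('t::finite, 'r::finite, 'n::finite) params \<Rightarrow> (side \<Rightarrow> complex^'n) \<Rightarrow> nat \<Rightarrow> complex" where
  "chi2 p \<theta> k =
     dh p k / pb p * trace (Psi_sum p \<theta>) * (\<Sum>j\<in>users p. pu p j * dh_til p j)"

end

theory Submission
  imports Defs
begin

text \<open>
  Write \<open>t\<^sub>m = Tr (A\<^sub>m \<Theta>\<^sub>m\<^sup>H)\<close>. Every quantity depends on \<open>\<theta>\<close> only through the two scalars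
  \<open>t\<^sub>r\<close> and \<open>t\<^sub>t\<close>, and the Wirtinger gradient of \<open>t\<^sub>m\<close> is \<open>a\<^sub>m\<close>; so each gradient is \<open>a\<^sub>m\<close> times a
  derivative with respect to \<open>t\<^sub>m\<close>. Since \<open>R\<^sub>s\<close> is positive semidefinite, \<open>t\<^sub>m\<close> is a nonnegative real (the
  trace of a product of two positive semidefinite matrices), hence all matrices to be inverted are
  positive definite. With \<open>R = c t B\<close> and \<open>Q' = - Q R' Q\<close>, cyclicity of the trace gives
  \<open>Tr (M (R Q R)') = c t' Tr (B (Q R M - Q R M R Q + M R Q))\<close>; all the matrices \<open>B\<close>, \<open>C\<close>, \<open>L\<close> of
  the theorem are instances of the right-hand side for various \<open>M\<close>.
\<close>

subsection \<open>Positive semidefinite matrices\<close>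

definition quad_form :: "complex^'n^'n \<Rightarrow> complex^'n \<Rightarrow> complex" where
  "quad_form A x = (\<Sum>i\<in>UNIV. cnj (x $ i) * (A *v x) $ i)"

lemma quad_form_eq:
  "quad_form A x = (\<Sum>i\<in>UNIV. \<Sum>j\<in>UNIV. cnj (x $ i) * A $ i $ j * x $ j)"
  by (simp add: quad_form_def matrix_vector_mult_def sum_distrib_left mult.assoc)

lemma hermitian_psd_iff:
  "hermitian_psd A \<longleftrightarrow> (\<forall>i j. cnj (A $ j $ i) = A $ i $ j) \<and> (\<forall>x. 0 \<le> Re (quad_form A x))"
  by (simp add: hermitian_psd_def quad_form_eq ctranspose_def vec_eq_iff)

lemma hermitian_psd_cnj: "hermitian_psd A \<Longrightarrow> cnj (A $ i $ j) = A $ j $ i"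
  by (simp add: hermitian_psd_iff)

lemma Re_quad_form_nonneg: "hermitian_psd A \<Longrightarrow> 0 \<le> Re (quad_form A x)"
  by (simp add: hermitian_psd_iff)

text \<open>By Hermitian symmetry, pairing \<open>x\<close> with column \<open>a\<close> gives the
  conjugate of \<open>(A *v x) $ a\<close>; the two cross terms are thus conjugate and add up to
  twice a real part.\<close>

lemma quad_form_add_axis:
  assumes h: "\<And>i j. cnj (A $ j $ i) = A $ i $ j"
  shows "quad_form A (x + axis a c) =
    quad_form A x + 2 * Re (cnj c * (A *v x) $ a) + c * cnj c * A $ a $ a"
proof -
  have row: "(\<Sum>i\<in>UNIV. cnj (x $ i) * A $ i $ a) = cnj ((A *v x) $ a)"
    by (simp add: matrix_vector_mult_def h mult.commute)
  have mv: "(A *v (x + axis a c)) $ i = (A *v x) $ i + c * A $ i $ a" for i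
    by (simp add: matrix_vector_right_distrib)
      (simp add: matrix_vector_mult_def axis_def if_distrib mult.commute cong: if_cong)
  have "quad_form A (x + axis a c) =
      (\<Sum>i\<in>UNIV. cnj (x $ i) * (A *v x) $ i + c * (cnj (x $ i) * A $ i $ a)
        + (if i = a then cnj c * ((A *v x) $ i + c * A $ i $ a) else 0))"
    unfolding quad_form_def mv
    by (intro sum.cong) (auto simp: axis_def algebra_simps)
  also have "\<dots> = quad_form A x + c * cnj ((A *v x) $ a)
      + cnj c * ((A *v x) $ a + c * A $ a $ a)"
    by (simp add: sum.distrib quad_form_def row flip: sum_distrib_left)
  also have "\<dots> = quad_form A x + (cnj c * (A *v x) $ a + cnj (cnj c * (A *v x) $ a))
      + c * cnj c * A $ a $ a"
    by (simp add: algebra_simps)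
  finally show ?thesis
    by (simp only: complex_add_cnj)
qed

lemma hermitian_psd_diag_nonneg:
  assumes "hermitian_psd A"
  shows "0 \<le> Re (A $ a $ a)" "Im (A $ a $ a) = 0"
proof -
  have "quad_form A (0 + axis a 1) = A $ a $ a"
    using assms by (subst quad_form_add_axis) (auto simp: hermitian_psd_iff quad_form_def)
  then show "0 \<le> Re (A $ a $ a)"
    using Re_quad_form_nonneg[OF assms, of "0 + axis a 1"] by simp
  show "Im (A $ a $ a) = 0"
    using hermitian_psd_cnj[OF assms, of a a] by (simp add: complex_eq_iff)
qed

text \<open>With a zero diagonal entry the expansion in \<open>quad_form_add_axis\<close> loses its
  quadratic term in \<open>c\<close>, so a nonzero entry in row \<open>a\<close> would let the form
  become negative.\<close>

lemma hermitian_psd_zero_diag: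
  assumes A: "hermitian_psd A" and z: "A $ a $ a = 0"
  shows "A $ a $ j = 0"
proof (rule ccontr)
  assume nz: "A $ a $ j \<noteq> 0"
  text \<open>Chosen such that the form takes the value \<open>-1\<close> at \<open>axis j 1 + axis a c\<close>.\<close>
  define r where "r = - (Re (A $ j $ j) + 1) / (2 * (cmod (A $ a $ j))\<^sup>2)"
  define c where "c = r * A $ a $ j"
  have mv: "(A *v axis j 1) $ a = A $ a $ j"
    by (simp add: matrix_vector_mult_def axis_def if_distrib cong: if_cong)
  have q: "quad_form A (axis j 1) = A $ j $ j"
    by (simp add: quad_form_def matrix_vector_mult_def axis_def if_distrib if_distribR cong: if_cong)
  have c: "cnj c * A $ a $ j = of_real (r * (cmod (A $ a $ j))\<^sup>2)"
    unfolding c_def using complex_norm_square[of "A $ a $ j"] by (simp add: mult_ac)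
  have "quad_form A (axis j 1 + axis a c) = A $ j $ j + 2 * Re (cnj c * A $ a $ j)"
    using A z by (subst quad_form_add_axis) (auto simp: hermitian_psd_iff q mv)
  then have "Re (quad_form A (axis j 1 + axis a c)) =
      Re (A $ j $ j) + 2 * (r * (cmod (A $ a $ j))\<^sup>2)"
    unfolding c by simp
  also have "\<dots> = - 1"
    using nz by (simp add: r_def field_simps)
  finally show False
    using Re_quad_form_nonneg[OF A, of "axis j 1 + axis a c"] by simp
qed

text \<open>One step of a Cholesky-type elimination: the subtracted rank-one matrix agrees with
  \<open>A\<close> on row and column \<open>a\<close>, so the support shrinks by one index.\<close>

lemma hermitian_psd_schur_complement:
  assumes A: "hermitian_psd A" and a: "A $ a $ a \<noteq> 0"
  shows "hermitian_psd (\<chi> i j. A $ i $ j - A $ i $ a * A $ a $ j / A $ a $ a)"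
    (is "hermitian_psd ?S")
proof -
  obtain d where d: "A $ a $ a = complex_of_real d" "d \<noteq> 0"
    using hermitian_psd_diag_nonneg[OF A, of a] a
    by (metis complex_eq_iff Re_complex_of_real Im_complex_of_real of_real_0)
  have "0 \<le> Re (quad_form ?S x)" for x
  proof -
    text \<open>\<open>c\<close> minimises the form on \<open>x + axis a c\<close>; the minimum is the value of the Schur complement.\<close>
    define y where "y = (A *v x) $ a"
    define c where "c = - y / A $ a $ a"
    have "quad_form ?S x = quad_form A x - (\<Sum>i\<in>UNIV. cnj (x $ i) * A $ i $ a) * y / A $ a $ a"
      by (simp add: quad_form_def y_def matrix_vector_mult_def sum_subtractf left_diff_distrib
          right_diff_distrib sum_divide_distrib sum_product sum_distrib_left mult_ac)
    also have "(\<Sum>i\<in>UNIV. cnj (x $ i) * A $ i $ a) = cnj y"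
      using A by (simp add: y_def matrix_vector_mult_def hermitian_psd_cnj mult.commute)
    also have "quad_form A x - cnj y * y / A $ a $ a = quad_form A (x + axis a c)"
    proof -
      have c: "cnj c * y = - of_real ((cmod y)\<^sup>2 / d)"
        using complex_norm_square[of y] by (simp add: c_def d mult.commute)
      have "c * cnj c * A $ a $ a = cnj y * y / A $ a $ a"
        using d(2) by (simp add: c_def d(1) field_simps)
      moreover have "complex_of_real (Re (cnj c * y)) = - (cnj y * y / A $ a $ a)"
        unfolding c d(1) by (simp only: complex_norm_square[of y, symmetric] mult.commute[of "cnj y"]
            Re_complex_of_real flip: of_real_divide of_real_minus)
      moreover have "quad_form A (x + axis a c) =
          quad_form A x + 2 * Re (cnj c * y) + c * cnj c * A $ a $ a"
        using A unfolding y_def by (subst quad_form_add_axis) (simp_all add: hermitian_psd_iff)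
      ultimately show ?thesis
        by (simp only: of_real_mult) simp
    qed
    finally show ?thesis
      using Re_quad_form_nonneg[OF A] by simp
  qed
  moreover have "cnj (?S $ j $ i) = ?S $ i $ j" for i j
    using hermitian_psd_cnj[OF A] by (simp add: mult.commute)
  ultimately show ?thesis
    by (simp add: hermitian_psd_iff)
qed

text \<open>Each Schur complement splits off a rank-one summand, contributing a value of the form of \<open>B\<close>.\<close>

lemma Re_sum_hermitian_psd_prod_nonneg:
  assumes A: "hermitian_psd A" and B: "hermitian_psd B"
  shows "0 \<le> Re (\<Sum>i\<in>UNIV. \<Sum>j\<in>UNIV. A $ i $ j * B $ i $ j)"
proof -
  \<comment> \<open>\<open>S\<close> contains the indices of all nonzero rows of \<open>A\<close>.
    \<open>A\<close> varies in the induction, since the step may replace it by its Schur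
    complement.\<close>
  have "0 \<le> Re (\<Sum>i\<in>UNIV. \<Sum>j\<in>UNIV. A $ i $ j * B $ i $ j)"
    if "finite S" "hermitian_psd A" "\<And>i j. i \<notin> S \<Longrightarrow> A $ i $ j = 0" for S A
    using that
  proof (induction S arbitrary: A)
    case empty
    then show ?case by simp
  next
    case (insert a S)
    show ?case
    proof (cases "A $ a $ a = 0")
      case True
      then have "A $ i $ j = 0" if "i \<notin> S" for i j
        using that insert.prems(2) hermitian_psd_zero_diag[OF insert.prems(1)] by (cases "i = a") auto
      then show ?thesis
        by (rule insert.IH[OF insert.prems(1)])
    next
      case False
      define C where "C = (\<chi> i j. A $ i $ j - A $ i $ a * A $ a $ j / A $ a $ a)"
      have "0 \<le> Re (\<Sum>i\<in>UNIV. \<Sum>j\<in>UNIV. C $ i $ j * B $ i $ j)"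
      proof (rule insert.IH)
        show "hermitian_psd C"
          unfolding C_def by (rule hermitian_psd_schur_complement[OF insert.prems(1) False])
        show "C $ i $ j = 0" if "i \<notin> S" for i j
          using that insert.prems(2) False by (cases "i = a") (auto simp: C_def)
      qed
      \<comment> \<open>As \<open>A $ i $ a\<close> is the conjugate of \<open>A $ a $ i\<close>,
        weighting \<open>B\<close> by the split-off matrix gives the form of \<open>B\<close> at row
        \<open>a\<close> of \<open>A\<close>, divided by the pivot.\<close>
      moreover have "(\<Sum>i\<in>UNIV. \<Sum>j\<in>UNIV. A $ i $ j * B $ i $ j) =
          (\<Sum>i\<in>UNIV. \<Sum>j\<in>UNIV. C $ i $ j * B $ i $ j)
          + quad_form B (\<chi> i. A $ a $ i) / A $ a $ a"
        using hermitian_psd_cnj[OF insert.prems(1)]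
        by (simp add: C_def quad_form_eq sum_divide_distrib sum.distrib[symmetric] algebra_simps)
      moreover have "0 \<le> Re (quad_form B (\<chi> i. A $ a $ i) / A $ a $ a)"
        using hermitian_psd_diag_nonneg[OF insert.prems(1), of a] Re_quad_form_nonneg[OF B]
        by (simp add: Re_divide field_simps power2_eq_square)
      ultimately show ?thesis by simp
    qed
  qed
  from this[of UNIV A] A show ?thesis by simp
qed

text \<open>The kernel is trivial: pairing the kernel equation with \<open>x\<close> and taking real
  parts writes zero as a nonnegative number plus \<open>c\<close> times the squared norm of
  \<open>x\<close>.\<close>

lemma invertible_hermitian_psd_add:
  assumes A: "hermitian_psd A" and t: "0 \<le> t" and c: "0 < (c::real)"
  shows "invertible (complex_of_real t *\<^sub>M A + complex_of_real c *\<^sub>M mat 1)"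
proof -
  let ?X = "complex_of_real t *\<^sub>M A + complex_of_real c *\<^sub>M mat 1"
  have "x = 0" if x: "?X *v x = 0" for x
  proof -
    have "(?X *v x) $ i = of_real t * (A *v x) $ i + of_real c * x $ i" for i
    proof -
      have "(?X *v x) $ i = (\<Sum>j\<in>UNIV. of_real t * (A $ i $ j * x $ j)
          + (if i = j then of_real c * x $ j else 0))"
        by (auto simp: matrix_vector_mult_def mscale_def mat_def algebra_simps intro!: sum.cong)
      also have "\<dots> = of_real t * (A *v x) $ i + of_real c * x $ i"
        by (simp add: sum.distrib matrix_vector_mult_def sum_distrib_left)
      finally show ?thesis .
    qed
    then have e: "of_real t * (A *v x) $ i + of_real c * x $ i = 0" for i
      using x by (metis zero_index)
    have "0 = (\<Sum>i\<in>UNIV. cnj (x $ i) * (of_real t * (A *v x) $ i + of_real c * x $ i))"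
      by (simp only: e mult_zero_right sum.neutral_const)
    also have "\<dots> = of_real t * quad_form A x + of_real c * of_real (\<Sum>i\<in>UNIV. (cmod (x $ i))\<^sup>2)"
      by (simp add: quad_form_def complex_norm_square sum_distrib_left sum.distrib algebra_simps
            del: of_real_power)
    finally have "0 = t * Re (quad_form A x) + c * (\<Sum>i\<in>UNIV. (cmod (x $ i))\<^sup>2)"
      by (metis Re_complex_of_real plus_complex.simps(1) of_real_mult Re_complex_of_real
          Re_complex_of_real times_complex.simps(1) Im_complex_of_real diff_zero mult_zero_left zero_complex.simps(1))
    moreover have "0 \<le> t * Re (quad_form A x)"
      using t Re_quad_form_nonneg[OF A] by simp
    moreover have "0 \<le> (\<Sum>i\<in>UNIV. (cmod (x $ i))\<^sup>2)"
      by (simp add: sum_nonneg)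
    ultimately have "(\<Sum>i\<in>UNIV. (cmod (x $ i))\<^sup>2) = 0"
      using c by (smt (verit) mult_pos_pos)
    then show "x = 0"
      by (simp add: sum_nonneg_eq_0_iff vec_eq_iff)
  qed
  then show ?thesis
    by (simp add: invertible_left_inverse matrix_left_invertible_ker)
qed

section \<open>Reality and nonnegativity of the traces \<open>trA\<close>\<close>

lemma trA_eq:
  "trA p \<theta> m = (\<Sum>i\<in>UNIV. \<Sum>j\<in>UNIV. Rs p $ i $ j * (\<theta> m $ j * Rs p $ j $ i * cnj (\<theta> m $ i)))"
proof -
  have "trA p \<theta> m = (\<Sum>i\<in>UNIV. (Rs p ** diag (\<theta> m) ** Rs p) $ i $ i * cnj (\<theta> m $ i))"
    by (simp add: trA_def Amat_def trace_def matrix_matrix_mult_def ctranspose_def diag_def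
        if_distrib cong: if_cong)
  then show ?thesis
    by (simp add: matrix_matrix_mult_def diag_def if_distrib sum_distrib_right sum_distrib_left
        mult_ac cong: if_cong)
qed

text \<open>\<open>trA_eq\<close> pairs \<open>Rs\<close> entrywise with the congruence of its
  transpose by \<open>diag (\<theta> m)\<close>, which is again positive semidefinite. Swapping the
  two indices gives invariance under conjugation.\<close>

lemma trA_nonneg_real:
  assumes R: "hermitian_psd (Rs p)"
  shows "0 \<le> Re (trA p \<theta> m)" "trA p \<theta> m = of_real (Re (trA p \<theta> m))"
proof -
  define B where "B = (\<chi> i j. \<theta> m $ j * Rs p $ j $ i * cnj (\<theta> m $ i))"
  have q: "quad_form B x = quad_form (Rs p) (\<chi> i. cnj (\<theta> m $ i * x $ i))" for x
    unfolding quad_form_eq by (subst sum.swap) (simp add: B_def mult_ac)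
  have "hermitian_psd B"
    unfolding hermitian_psd_iff q using hermitian_psd_cnj[OF R] Re_quad_form_nonneg[OF R]
    by (simp add: B_def mult_ac)
  from Re_sum_hermitian_psd_prod_nonneg[OF R this]
  show "0 \<le> Re (trA p \<theta> m)" by (simp add: B_def trA_eq)
  have "cnj (trA p \<theta> m) = trA p \<theta> m"
    unfolding trA_eq using hermitian_psd_cnj[OF R]
    by (subst sum.swap) (simp add: mult_ac)
  then show "trA p \<theta> m = of_real (Re (trA p \<theta> m))"
    by (simp add: complex_eq_iff)
qed

subsection \<open>Calculus of complex matrices\<close>

text \<open>Difference quotients are the form in which an identity for differences of inverses can
  be used.\<close>

lemma has_vector_derivative_iff_quotient:
  fixes f :: "real \<Rightarrow> 'a::real_normed_vector"
  shows "(f has_vector_derivative d) (at x) \<longleftrightarrow> ((\<lambda>y. (f y - f x) /\<^sub>R (y - x)) \<longlongrightarrow> d) (at x)"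
proof -
  have "(f has_vector_derivative d) (at x) \<longleftrightarrow>
      ((\<lambda>y. norm ((f y - f x - (y - x) *\<^sub>R d) /\<^sub>R norm (y - x))) \<longlongrightarrow> 0) (at x)"
    unfolding has_vector_derivative_def has_derivative_within tendsto_norm_zero_iff
    by (simp add: bounded_linear_scaleR_left diff_diff_eq2 diff_diff_eq field_simps)
  also have "\<dots> \<longleftrightarrow> ((\<lambda>y. norm ((f y - f x) /\<^sub>R (y - x) - d)) \<longlongrightarrow> 0) (at x)"
  proof (rule filterlim_cong[OF refl refl])
    show "\<forall>\<^sub>F y in at x. norm ((f y - f x - (y - x) *\<^sub>R d) /\<^sub>R norm (y - x)) =
        norm ((f y - f x) /\<^sub>R (y - x) - d)"
      unfolding eventually_at_filter
    proof (intro always_eventually allI impI)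
      fix y assume "y \<noteq> x"
      then have "(f y - f x) /\<^sub>R (y - x) - d = (f y - f x - (y - x) *\<^sub>R d) /\<^sub>R (y - x)"
        by (simp add: scaleR_diff_right)
      then show "norm ((f y - f x - (y - x) *\<^sub>R d) /\<^sub>R norm (y - x)) =
          norm ((f y - f x) /\<^sub>R (y - x) - d)"
        by simp
    qed
  qed
  also have "\<dots> \<longleftrightarrow> ((\<lambda>y. (f y - f x) /\<^sub>R (y - x)) \<longlongrightarrow> d) (at x)"
    by (simp add: tendsto_norm_zero_iff LIM_zero_iff)
  finally show ?thesis .
qed

lemma matrix_mult_mscale: "A ** (c *\<^sub>M B) = c *\<^sub>M (A ** B)" "(c *\<^sub>M A) ** B = c *\<^sub>M (A ** B)"
  by (simp_all add: mscale_def matrix_matrix_mult_def vec_eq_iff sum_distrib_left mult_ac)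

lemma trace_mscale: "trace (c *\<^sub>M A) = c * trace A"
  by (simp add: mscale_def trace_def sum_distrib_left)

lemma bounded_bilinear_matrix_mult:
  "bounded_bilinear ((**) :: complex^'m^'n \<Rightarrow> complex^'k^'m \<Rightarrow> complex^'k^'n)"
  unfolding bilinear_conv_bounded_bilinear[symmetric]
  by (auto simp: bilinear_def linear_iff matrix_matrix_mult_def vec_eq_iff sum.distrib
      distrib_left distrib_right scaleR_sum_right)

lemma bounded_bilinear_mscale:
  "bounded_bilinear (mscale :: complex \<Rightarrow> complex^'m^'n \<Rightarrow> _)"
  unfolding bilinear_conv_bounded_bilinear[symmetric]
  by (auto simp: bilinear_def linear_iff mscale_def vec_eq_iff distrib_left distrib_right)

lemma bounded_linear_trace: "bounded_linear (trace :: complex^'n^'n \<Rightarrow> complex)"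
  unfolding linear_conv_bounded_linear[symmetric]
  by (auto simp: linear_iff trace_def sum.distrib scaleR_sum_right)

lemmas matrix_mult_diff_left = bounded_bilinear.diff_left[OF bounded_bilinear_matrix_mult]
lemmas matrix_mult_diff_right = bounded_bilinear.diff_right[OF bounded_bilinear_matrix_mult]

section \<open>The matrix inverse: Cramer's rule, continuity, derivative\<close>

lemma matrix_inv_mult:
  assumes "invertible (A :: complex^'n^'n)"
  shows "A ** matrix_inv A = mat 1" "matrix_inv A ** A = mat 1"
  using someI_ex[OF assms[unfolded invertible_def]] by (auto simp: matrix_inv_def)

text \<open>Column \<open>l\<close> of the inverse solves the system with right-hand side
  \<open>axis l 1\<close>. The formula reduces continuity of the inverse to continuity of
  determinants.\<close>

lemma matrix_inv_cramer:
  assumes "invertible (A :: complex^'n^'n)"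
  shows "matrix_inv A =
    (\<chi> k l. det (\<chi> i j. if j = k then axis l 1 $ i else A $ i $ j) / det A)"
proof -
  have "column l (matrix_inv A) = (\<chi> k. det (\<chi> i j. if j = k then axis l 1 $ i else A $ i $ j) / det A)" for l
  proof -
    have "A *v column l (matrix_inv A) = column l (A ** matrix_inv A)"
      by (simp add: vec_eq_iff column_def matrix_vector_mult_def matrix_matrix_mult_def)
    also have "\<dots> = axis l 1"
      using assms by (simp add: matrix_inv_mult vec_eq_iff column_def mat_def axis_def)
    finally show ?thesis
      using assms by (subst (asm) cramer) (auto simp: invertible_det_nz)
  qed
  then show ?thesis
    by (simp add: vec_eq_iff column_def)
qed

lemma tendsto_det:
  fixes F :: "'b \<Rightarrow> complex^'n^'n"
  assumes "\<And>i j. ((\<lambda>x. F x $ i $ j) \<longlongrightarrow> A $ i $ j) net"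
  shows "((\<lambda>x. det (F x)) \<longlongrightarrow> det A) net"
  unfolding det_def by (intro tendsto_intros assms)

lemma tendsto_matrix_inv:
  fixes F :: "'b \<Rightarrow> complex^'n^'n"
  assumes F: "(F \<longlongrightarrow> A) net" and A: "invertible A"
    and inv: "\<And>x. invertible (F x)"
  shows "((\<lambda>x. matrix_inv (F x)) \<longlongrightarrow> matrix_inv A) net"
  unfolding matrix_inv_cramer[OF A] matrix_inv_cramer[OF inv]
proof (intro tendsto_vec_lambda tendsto_divide)
  have e: "((\<lambda>x. F x $ i $ j) \<longlongrightarrow> A $ i $ j) net" for i j
    by (intro tendsto_vec_nth F)
  show "((\<lambda>x. det (F x)) \<longlongrightarrow> det A) net"
    by (rule tendsto_det[OF e])
  show "((\<lambda>x. det (\<chi> i j. if j = k then axis l 1 $ i else F x $ i $ j)) \<longlongrightarrow>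
      det (\<chi> i j. if j = k then axis l 1 $ i else A $ i $ j)) net" for k l
    by (rule tendsto_det) (simp add: e)
  show "det A \<noteq> 0"
    using A by (simp add: invertible_det_nz)
qed

text \<open>The resolvent identity: expand the middle difference and cancel each matrix against its
  inverse.\<close>

lemma matrix_inv_diff:
  assumes "invertible (A :: complex^'n^'n)" "invertible B"
  shows "matrix_inv A - matrix_inv B = - (matrix_inv A ** (A - B) ** matrix_inv B)"
  using assms
  by (simp add: matrix_mult_diff_left matrix_mult_diff_right matrix_inv_mult
      flip: matrix_mul_assoc[of _ B])

lemma has_vector_derivative_matrix_inv:
  fixes F :: "real \<Rightarrow> complex^'n^'n"
  assumes F: "(F has_vector_derivative F') (at x)" and inv: "\<And>y. invertible (F y)"
  shows "((\<lambda>y. matrix_inv (F y)) has_vector_derivative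
    - (matrix_inv (F x) ** F' ** matrix_inv (F x))) (at x)"
proof -
  interpret mm: bounded_bilinear "(**) :: complex^'n^'n \<Rightarrow> complex^'n^'n \<Rightarrow> complex^'n^'n"
    by (rule bounded_bilinear_matrix_mult)
  have "(F \<longlongrightarrow> F x) (at x)"
    using has_vector_derivative_continuous[OF F] by (simp add: continuous_at isCont_def)
  then have c: "((\<lambda>y. matrix_inv (F y)) \<longlongrightarrow> matrix_inv (F x)) (at x)"
    by (intro tendsto_matrix_inv inv)
  \<comment> \<open>The resolvent identity divided by \<open>y - x\<close>; of the two inverses only
    the left one depends on \<open>y\<close>, and it converges by continuity.\<close>
  have q: "(matrix_inv (F y) - matrix_inv (F x)) /\<^sub>R (y - x) =
      - (matrix_inv (F y) ** ((F y - F x) /\<^sub>R (y - x)) ** matrix_inv (F x))" for y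
    by (simp add: matrix_inv_diff[OF inv inv] mm.scaleR_left mm.scaleR_right)
  show ?thesis
    unfolding has_vector_derivative_iff_quotient q
    by (intro tendsto_minus mm.tendsto c tendsto_const F[unfolded has_vector_derivative_iff_quotient])
qed

lemma has_vector_derivative_inverse:
  fixes f :: "real \<Rightarrow> 'a::real_normed_field"
  assumes "(f has_vector_derivative f') (at x)" "f x \<noteq> 0"
  shows "((\<lambda>y. inverse (f y)) has_vector_derivative - f' / (f x)\<^sup>2) (at x)"
proof -
  have "((\<lambda>y. inverse (f y)) has_derivative
      (\<lambda>h. - (inverse (f x) * (h *\<^sub>R f') * inverse (f x)))) (at x)"
    using assms by (intro Deriv.has_derivative_inverse) (simp_all add: has_vector_derivative_def)
  moreover have "(\<lambda>h. - (inverse (f x) * (h *\<^sub>R f') * inverse (f x))) =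
      (\<lambda>h. h *\<^sub>R (- f' / (f x)\<^sup>2))"
    by (simp add: fun_eq_iff divide_inverse power2_eq_square mult_ac)
  ultimately show ?thesis
    by (simp add: has_vector_derivative_def)
qed

section \<open>Derivatives of scaled matrices, of traces and of \<open>R Q R\<close>\<close>

lemma has_vector_derivative_mscale_left:
  assumes "(f has_vector_derivative f') (at x)"
  shows "((\<lambda>s. f s *\<^sub>M (A :: complex^'k^'l)) has_vector_derivative f' *\<^sub>M A) (at x)"
proof -
  interpret ms: bounded_bilinear "mscale :: complex \<Rightarrow> complex^'k^'l \<Rightarrow> complex^'k^'l"
    by (rule bounded_bilinear_mscale)
  show ?thesis
    using ms.has_vector_derivative[OF assms has_vector_derivative_const[of A]]
    by (simp add: ms.zero_right)
qed

text \<open>Cyclicity puts the differentiated factor on the right in both summands, the position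
  that \<open>trace_RQR_derivative\<close> expects.\<close>

lemma has_vector_derivative_trace_mult:
  fixes F G :: "real \<Rightarrow> complex^'k^'k"
  assumes "(F has_vector_derivative F') (at x)" "(G has_vector_derivative G') (at x)"
  shows "((\<lambda>s. trace (F s ** G s)) has_vector_derivative trace (G x ** F') + trace (F x ** G')) (at x)"
  using bounded_linear.has_vector_derivative[OF bounded_linear_trace
      bounded_bilinear.has_vector_derivative[OF bounded_bilinear_matrix_mult assms]]
  by (simp add: trace_add trace_mul_sym[of F'] add.commute)

lemma has_vector_derivative_trace:
  fixes F :: "real \<Rightarrow> complex^'k^'k"
  assumes "(F has_vector_derivative F') (at x)"
  shows "((\<lambda>s. trace (F s)) has_vector_derivative trace F') (at x)"
  by (rule bounded_linear.has_vector_derivative[OF bounded_linear_trace assms])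

text \<open>Serves both \<open>Psi_til\<close> and \<open>Psi\<close>: \<open>t\<close> becomes a
  trace \<open>trA\<close>, \<open>d\<close> the product of path losses and \<open>c\<close> the
  noise variance divided by pilot length and training power.\<close>

lemma has_vector_derivative_RQR:
  fixes B :: "complex^'n^'n"
  assumes R: "\<And>s. R s = (d * t s) *\<^sub>M B" and Q: "\<And>s. Q s = matrix_inv (R s + c *\<^sub>M mat 1)"
    and t: "(t has_vector_derivative t') (at x)" and inv: "\<And>s. invertible (R s + c *\<^sub>M mat 1)"
  shows "((\<lambda>s. R s ** Q s ** R s) has_vector_derivative
    (d * t') *\<^sub>M (B ** Q x ** R x - R x ** Q x ** B ** Q x ** R x + R x ** Q x ** B)) (at x)"
proof -
  interpret mm: bounded_bilinear "(**) :: complex^'n^'n \<Rightarrow> complex^'n^'n \<Rightarrow> complex^'n^'n"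
    by (rule bounded_bilinear_matrix_mult)
  interpret ms: bounded_bilinear "mscale :: complex \<Rightarrow> complex^'n^'n \<Rightarrow> complex^'n^'n"
    by (rule bounded_bilinear_mscale)
  have R': "(R has_vector_derivative (d * t') *\<^sub>M B) (at x)"
    unfolding R using ms.has_vector_derivative[OF has_vector_derivative_mult_right[OF t, of d]
      has_vector_derivative_const[of B]] by (simp add: ms.zero_right)
  have "((\<lambda>s. R s + c *\<^sub>M mat 1) has_vector_derivative (d * t') *\<^sub>M B) (at x)"
    by (simp add: has_vector_derivative_add_const R')
  from has_vector_derivative_matrix_inv[OF this inv]
  have Q': "(Q has_vector_derivative - (Q x ** ((d * t') *\<^sub>M B) ** Q x)) (at x)"
    by (simp flip: Q)
  from mm.has_vector_derivative[OF mm.has_vector_derivative[OF R' Q'] R']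
  show ?thesis
    by (rule has_vector_derivative_eq_rhs)
      (simp add: matrix_mult_mscale mm.add_left mm.diff_left mm.minus_left mm.minus_right ms.add_right
        ms.diff_right matrix_mul_assoc)
qed

lemma trace_RQR_derivative:
  fixes B :: "complex^'n^'n"
  shows "trace (M ** (c *\<^sub>M (B ** Q ** R - R ** Q ** B ** Q ** R + R ** Q ** B))) =
    c * trace (B ** (Q ** R ** M - Q ** R ** M ** R ** Q + M ** R ** Q))"
proof -
  have "trace (M ** B ** Q ** R) = trace (B ** Q ** R ** M)"
    using trace_mul_sym[of M "B ** Q ** R"] by (simp add: matrix_mul_assoc)
  moreover have "trace (M ** R ** Q ** B ** Q ** R) = trace (B ** Q ** R ** M ** R ** Q)"
    using trace_mul_sym[of "M ** R ** Q" "B ** Q ** R"] by (simp add: matrix_mul_assoc)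
  moreover have "trace (M ** R ** Q ** B) = trace (B ** M ** R ** Q)"
    using trace_mul_sym[of "M ** R ** Q" B] by (simp add: matrix_mul_assoc)
  ultimately show ?thesis
    by (simp add: matrix_mult_mscale trace_mscale matrix_add_ldistrib matrix_mult_diff_right
        matrix_mul_assoc trace_add trace_sub)
qed

subsection \<open>Derivatives along curves\<close>

text \<open>All functions see \<open>\<theta>\<close> only through the two traces, so the velocities
  \<open>\<tau>\<close> of these at 0 determine every derivative. Coordinate lines in real and
  imaginary directions are the instances used later.\<close>

locale trace_curve =
  fixes p :: "('t::finite, 'r::finite, 'n::finite) params"
    and \<theta> :: "real \<Rightarrow> side \<Rightarrow> complex^'n"
    and \<tau> :: "side \<Rightarrow> complex"
  assumes valid: "valid_params p"
    and trA_deriv: "\<And>w. ((\<lambda>s. trA p (\<theta> s) w) has_vector_derivative \<tau> w) (at 0)"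
begin

text \<open>The derivative of \<open>Psi_til\<close> at 0 in the shape delivered by
  \<open>has_vector_derivative_RQR\<close>; \<open>dPsi\<close> is its analogue for
  \<open>Psi\<close>.\<close>

definition "dPsi_til k = (dg_til p * dh_til p k * \<tau> Rside) *\<^sub>M
  (Rb_til p ** Q_til p (\<theta> 0) k ** R_til p (\<theta> 0) k
   - R_til p (\<theta> 0) k ** Q_til p (\<theta> 0) k ** Rb_til p ** Q_til p (\<theta> 0) k ** R_til p (\<theta> 0) k
   + R_til p (\<theta> 0) k ** Q_til p (\<theta> 0) k ** Rb_til p)"

definition "dPsi k = (dg p * dh p k * \<tau> (side_of p k)) *\<^sub>M
  (Rb p ** Qmat p (\<theta> 0) k ** Rmat p (\<theta> 0) k
   - Rmat p (\<theta> 0) k ** Qmat p (\<theta> 0) k ** Rb p ** Qmat p (\<theta> 0) k ** Rmat p (\<theta> 0) k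
   + Rmat p (\<theta> 0) k ** Qmat p (\<theta> 0) k ** Rb p)"

text \<open>\<open>trA\<close> is a nonnegative real, so this is a nonnegative multiple of a
  positive semidefinite matrix plus a positive multiple of the identity. It holds at every
  \<open>\<theta>'\<close>, hence all along the curve.\<close>

lemma invertible_til:
  assumes "k \<in> users p"
  shows "invertible (R_til p \<theta>' k + (var_u p / (tau_up p * ptrain p)) *\<^sub>M mat 1)"
proof -
  have v: "hermitian_psd (Rb_til p)" "hermitian_psd (Rs p)" "0 < dg_til p" "0 < dh_til p k"
    "0 < var_u p" "0 < tau_up p" "0 < ptrain p"
    using valid assms by (auto simp: valid_params_def)
  have "R_til p \<theta>' k = complex_of_real (dg_til p * dh_til p k * Re (trA p \<theta>' Rside)) *\<^sub>M Rb_til p"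
    unfolding R_til_def by (subst trA_nonneg_real(2)[OF v(2)]) simp
  then show ?thesis
    using invertible_hermitian_psd_add[OF v(1),
        of "dg_til p * dh_til p k * Re (trA p \<theta>' Rside)" "var_u p / (tau_up p * ptrain p)"]
      v trA_nonneg_real(1)[OF v(2)] by simp
qed

lemma invertible_mat:
  assumes "k \<in> users p"
  shows "invertible (Rmat p \<theta>' k + (var_dk p k / (tau_dp p * ptrain p)) *\<^sub>M mat 1)"
proof -
  have v: "hermitian_psd (Rb p)" "hermitian_psd (Rs p)" "0 < dg p" "0 < dh p k"
    "0 < var_dk p k" "0 < tau_dp p" "0 < ptrain p"
    using valid assms by (auto simp: valid_params_def)
  let ?w = "side_of p k"
  have "Rmat p \<theta>' k = complex_of_real (dg p * dh p k * Re (trA p \<theta>' ?w)) *\<^sub>M Rb p"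
    unfolding Rmat_def by (subst trA_nonneg_real(2)[OF v(2)]) simp
  then show ?thesis
    using invertible_hermitian_psd_add[OF v(1),
        of "dg p * dh p k * Re (trA p \<theta>' ?w)" "var_dk p k / (tau_dp p * ptrain p)"]
      v trA_nonneg_real(1)[OF v(2)] by simp
qed

lemma Psi_til_deriv:
  assumes "k \<in> users p"
  shows "((\<lambda>s. Psi_til p (\<theta> s) k) has_vector_derivative dPsi_til k) (at 0)"
  unfolding Psi_til_def dPsi_til_def
  by (rule has_vector_derivative_RQR[where t = "\<lambda>s. trA p (\<theta> s) Rside"])
    (rule R_til_def Q_til_def trA_deriv invertible_til assms)+

lemma Psi_deriv:
  assumes "k \<in> users p"
  shows "((\<lambda>s. Psi p (\<theta> s) k) has_vector_derivative dPsi k) (at 0)"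
  unfolding Psi_def dPsi_def
  by (rule has_vector_derivative_RQR[where t = "\<lambda>s. trA p (\<theta> s) (side_of p k)"])
    (rule Rmat_def Qmat_def trA_deriv invertible_mat assms)+

lemma Psi_sum_deriv:
  "((\<lambda>s. Psi_sum p (\<theta> s)) has_vector_derivative (\<Sum>j\<in>users p. dPsi j)) (at 0)"
  unfolding Psi_sum_def by (intro has_vector_derivative_sum Psi_deriv)

text \<open>All summands carry the same trace and the same matrix, so only one scalar has to be
  differentiated.\<close>

lemma R_til_sum_eq:
  "R_til_sum p \<theta>' = (dg_til p * (\<Sum>j\<in>users p. dh_til p j * pu p j) * trA p \<theta>' Rside) *\<^sub>M Rb_til p"
  by (simp add: R_til_sum_def R_til_def mscale_def vec_eq_iff sum_distrib_left sum_distrib_right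
      mult_ac)

text \<open>\<open>M\<close> is left open: \<open>R_til_sum\<close>, \<open>Rb_til\<close>,
  \<open>Psi_til\<close> and \<open>mat 1\<close> give the brackets of \<open>B1_til\<close>,
  \<open>B2_til\<close>, \<open>B3_til\<close> and \<open>C_til\<close>.\<close>

lemma trace_dPsi_til:
  "trace (M ** dPsi_til k) = dg_til p * dh_til p k * \<tau> Rside * trace (Rb_til p **
    (Q_til p (\<theta> 0) k ** R_til p (\<theta> 0) k ** M
     - Q_til p (\<theta> 0) k ** R_til p (\<theta> 0) k ** M ** R_til p (\<theta> 0) k ** Q_til p (\<theta> 0) k
     + M ** R_til p (\<theta> 0) k ** Q_til p (\<theta> 0) k))"
  unfolding dPsi_til_def by (rule trace_RQR_derivative)

text \<open>Here \<open>Xi_til\<close>, \<open>Rmat\<close>, \<open>Psi\<close> and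
  \<open>mat 1\<close> in place of \<open>M\<close> lead to \<open>L_til\<close>,
  \<open>Lmat\<close>, \<open>Bmat\<close> and \<open>Cmat\<close>.\<close>

lemma trace_dPsi:
  "trace (M ** dPsi k) = dg p * dh p k * \<tau> (side_of p k) * trace (Rb p **
    (Qmat p (\<theta> 0) k ** Rmat p (\<theta> 0) k ** M
     - Qmat p (\<theta> 0) k ** Rmat p (\<theta> 0) k ** M ** Rmat p (\<theta> 0) k ** Qmat p (\<theta> 0) k
     + M ** Rmat p (\<theta> 0) k ** Qmat p (\<theta> 0) k))"
  unfolding dPsi_def by (rule trace_RQR_derivative)

lemma trace_dPsi_til_C:
  "trace (dPsi_til k) = dg_til p * dh_til p k * \<tau> Rside * trace (Rb_til p ** C_til p (\<theta> 0) k)"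
  using trace_dPsi_til[of "mat 1"] by (simp add: C_til_def matrix_mul_assoc)

lemma trace_dPsi_C:
  "trace (dPsi k) = dg p * dh p k * \<tau> (side_of p k) * trace (Rb p ** Cmat p (\<theta> 0) k)"
  using trace_dPsi[of "mat 1"] by (simp add: Cmat_def matrix_mul_assoc)

section \<open>Derivatives of the signal and interference terms\<close>

lemma S_u_deriv:
  assumes "k \<in> users p"
  shows "((\<lambda>s. S_u p k (\<theta> s)) has_vector_derivative nu_til p (\<theta> 0) k * \<tau> Rside) (at 0)"
  unfolding S_u_def power2_eq_square
  by (rule has_vector_derivative_eq_rhs,
      (rule has_vector_derivative_mult_right has_vector_derivative_mult has_vector_derivative_trace
        Psi_til_deriv assms)+)
    (simp add: trace_dPsi_til_C nu_til_def)

lemma S_d_deriv: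
  assumes "k \<in> users p"
  shows "((\<lambda>s. S_d p k (\<theta> s)) has_vector_derivative nu p (\<theta> 0) k * \<tau> (side_of p k)) (at 0)"
  unfolding S_d_def power2_eq_square
  by (rule has_vector_derivative_eq_rhs,
      (rule has_vector_derivative_mult has_vector_derivative_trace Psi_deriv assms)+)
    (simp add: trace_dPsi_C nu_def)

text \<open>One formula covers both gradients: the first group moves only with the
  \<open>Rside\<close> trace, while the sum weighs each user by the velocity on its own side, so
  that a \<open>\<tau>\<close> supported on one side selects \<open>Kr\<close> or
  \<open>Kt\<close>.\<close>

lemma I_u_deriv:
  assumes k: "k \<in> users p" and nz: "trace (Psi_sum p (\<theta> 0)) \<noteq> 0"
  shows "((\<lambda>s. I_u p k (\<theta> s)) has_vector_derivative
    (dg_til p * dh_til p k *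
       trace (Rb_til p ** (B1_til p (\<theta> 0) k + B2_til p (\<theta> 0) k - B3_til p (\<theta> 0) k
         + var_b p *\<^sub>M C_til p (\<theta> 0) k))
     + dg_til p * (\<Sum>j\<in>users p. dh_til p j * pu p j) * trace (Rb_til p ** Psi_til p (\<theta> 0) k)
     + chi_til p (\<theta> 0) k) * \<tau> Rside
    + dg p * (\<Sum>i\<in>users p. dh p i * trace (Rb p ** L_til p (\<theta> 0) k i) * \<tau> (side_of p i))) (at 0)"
proof -
  let ?\<theta> = "\<theta> 0" and ?P = "Psi_til p (\<theta> 0) k" and ?S = "Psi_sum p (\<theta> 0)"
  let ?dS = "\<Sum>j\<in>users p. dPsi j"
  \<comment> \<open>At parameter 0 the second term of \<open>I_u\<close> is
    \<open>pb p / T * a * b * g\<close>; \<open>q\<close> is the coefficient of the trace in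
    \<open>R_til_sum_eq\<close>.\<close>
  define T where "T = trace ?S"
  define a where "a = trace (?P ** Rb_til p)"
  define b where "b = trace (Rb p ** ?S)"
  define g where "g = dg p * dg_til p * trA p ?\<theta> Rside + var_L p"
  define q where "q = complex_of_real (dg_til p * (\<Sum>j\<in>users p. dh_til p j * pu p j))"
  have dT: "((\<lambda>s. inverse (trace (Psi_sum p (\<theta> s)))) has_vector_derivative
      - trace ?dS / T\<^sup>2) (at 0)"
    unfolding T_def by (intro has_vector_derivative_inverse has_vector_derivative_trace Psi_sum_deriv nz)
  have da: "((\<lambda>s. trace (Psi_til p (\<theta> s) k ** Rb_til p)) has_vector_derivative
      trace (Rb_til p ** dPsi_til k)) (at 0)"
    using has_vector_derivative_trace_mult[OF Psi_til_deriv[OF k] has_vector_derivative_const[of "Rb_til p"]]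
    by (simp add: trace_def)
  have db: "((\<lambda>s. trace (Rb p ** Psi_sum p (\<theta> s))) has_vector_derivative
      trace (Rb p ** ?dS)) (at 0)"
    using has_vector_derivative_trace_mult[OF has_vector_derivative_const[of "Rb p"] Psi_sum_deriv]
    by (simp add: trace_def)
  have g': "((\<lambda>s. dg p * dg_til p * trA p (\<theta> s) Rside + var_L p) has_vector_derivative
      dg p * dg_til p * \<tau> Rside) (at 0)"
    unfolding has_vector_derivative_add_const
    by (intro has_vector_derivative_mult_right trA_deriv)
  have dR: "((\<lambda>s. R_til_sum p (\<theta> s)) has_vector_derivative (q * \<tau> Rside) *\<^sub>M Rb_til p) (at 0)"
    unfolding R_til_sum_eq q_def
    by (intro has_vector_derivative_mscale_left has_vector_derivative_mult_right trA_deriv)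
  \<comment> \<open>Product rule, grouped by what varies: both factors of the first trace, then
    \<open>a\<close>, then \<open>b\<close> together with \<open>T\<close>, then \<open>g\<close>,
    and finally \<open>Psi_til\<close> in the subtracted square and in the noise term.\<close>
  have D: "((\<lambda>s. I_u p k (\<theta> s)) has_vector_derivative
      trace (R_til_sum p ?\<theta> ** dPsi_til k) + trace (?P ** ((q * \<tau> Rside) *\<^sub>M Rb_til p))
      + pb p * inverse T * trace (Rb_til p ** dPsi_til k) * b * g
      + (pb p * inverse T * a * g * trace (Rb p ** ?dS) - pb p * trace ?dS / T\<^sup>2 * a * b * g)
      + pb p * inverse T * a * b * (dg p * dg_til p) * \<tau> Rside
      - pu p k * (trace (?P ** dPsi_til k) + trace (?P ** dPsi_til k))
      + var_b p * trace (dPsi_til k)) (at 0)"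
    unfolding I_u_def divide_inverse
    by (rule has_vector_derivative_eq_rhs,
        (rule dT da db g' dR Psi_til_deriv k has_vector_derivative_add has_vector_derivative_diff
          has_vector_derivative_mult_right has_vector_derivative_mult has_vector_derivative_trace_mult has_vector_derivative_trace)+)
      (simp add: T_def a_def b_def g_def divide_inverse algebra_simps)
  have e1: "trace (?P ** ((q * \<tau> Rside) *\<^sub>M Rb_til p)) =
      q * trace (Rb_til p ** ?P) * \<tau> Rside"
    by (simp add: matrix_mult_mscale trace_mscale trace_mul_sym[of ?P])
  have e2: "pb p * inverse T * a * b * (dg p * dg_til p) = chi_til p ?\<theta> k"
    by (simp add: chi_til_def T_def a_def b_def divide_inverse)
  have e3: "trace (R_til_sum p ?\<theta> ** dPsi_til k) =
      dg_til p * dh_til p k * \<tau> Rside * trace (Rb_til p ** B1_til p ?\<theta> k)"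
    by (simp add: trace_dPsi_til B1_til_def)
  have e4: "pb p * inverse T * trace (Rb_til p ** dPsi_til k) * b * g =
      dg_til p * dh_til p k * \<tau> Rside * trace (Rb_til p ** B2_til p ?\<theta> k)"
    by (simp add: trace_dPsi_til B2_til_def varpi_def T_def b_def g_def matrix_mult_mscale
        trace_mscale divide_inverse)
  \<comment> \<open>The two factors of the square contribute equally, whence the 2 in
    \<open>B3_til\<close>.\<close>
  have e5: "pu p k * (trace (?P ** dPsi_til k) + trace (?P ** dPsi_til k)) =
      dg_til p * dh_til p k * \<tau> Rside * trace (Rb_til p ** B3_til p ?\<theta> k)"
    by (simp add: trace_dPsi_til B3_til_def matrix_mult_mscale trace_mscale)
  \<comment> \<open>The variations of \<open>b\<close> and \<open>T\<close> form the quotient rule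
    for \<open>b / T\<close>. \<open>Xi_til\<close> is the matrix whose trace pairing with the
    variation of \<open>Psi_sum\<close> gives this derivative, including the factor
    \<open>pb p * a * g\<close>.\<close>
  have e6: "pb p * inverse T * a * g * trace (Rb p ** ?dS)
      - pb p * trace ?dS / T\<^sup>2 * a * b * g =
      dg p * (\<Sum>i\<in>users p. dh p i * trace (Rb p ** L_til p ?\<theta> k i) * \<tau> (side_of p i))"
  proof -
    have "trace (Xi_til p ?\<theta> k ** dPsi j) =
        dg p * (dh p j * trace (Rb p ** L_til p ?\<theta> k j) * \<tau> (side_of p j))" for j
      by (simp add: trace_dPsi L_til_def)
    then have "dg p * (\<Sum>i\<in>users p. dh p i * trace (Rb p ** L_til p ?\<theta> k i) * \<tau> (side_of p i)) =
        (\<Sum>j\<in>users p. trace (Xi_til p ?\<theta> k ** dPsi j))"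
      by (simp add: sum_distrib_left)
    also have "\<dots> = trace (Xi_til p ?\<theta> k ** ?dS)"
      by (simp add: bounded_bilinear.sum_right[OF bounded_bilinear_matrix_mult]
          linear_sum[OF bounded_linear.linear[OF bounded_linear_trace]])
    also have "\<dots> = pb p / T * a * g * (trace (Rb p ** ?dS) - b / T * trace ?dS)"
      by (simp add: Xi_til_def T_def a_def b_def g_def matrix_mult_mscale trace_mscale
          matrix_mult_diff_left trace_sub)
    finally show ?thesis
      by (simp add: divide_inverse power2_eq_square algebra_simps)
  qed
  have e7: "trace (Rb_til p ** (B1_til p ?\<theta> k + B2_til p ?\<theta> k - B3_til p ?\<theta> k
         + var_b p *\<^sub>M C_til p ?\<theta> k)) =
      trace (Rb_til p ** B1_til p ?\<theta> k) + trace (Rb_til p ** B2_til p ?\<theta> k)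
      - trace (Rb_til p ** B3_til p ?\<theta> k) + var_b p * trace (Rb_til p ** C_til p ?\<theta> k)"
    by (simp add: matrix_add_ldistrib matrix_mult_diff_right trace_add trace_sub
        matrix_mult_mscale trace_mscale)
  show ?thesis
    by (rule has_vector_derivative_eq_rhs[OF D])
      (simp only: e1 e2 e3 e4 e5 e6 e7 trace_dPsi_til_C, simp add: q_def algebra_simps)
qed

text \<open>\<open>Psi_sum\<close> enters linearly, paired with \<open>Rmat\<close> of user
  \<open>k\<close> and with the scalar \<open>chi1\<close>; this yields the sum over all users. The
  trace of the user's own side also moves \<open>Rmat\<close>, the squared \<open>Psi\<close> and
  the scalar sum, which yields the first group.\<close>

lemma I_d_deriv:
  assumes k: "k \<in> users p"
  shows "((\<lambda>s. I_d p k (\<theta> s)) has_vector_derivative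
    (dg p * dh p k * trace (Rb p ** (Psi_sum p (\<theta> 0) - Bmat p (\<theta> 0) k)) + chi2 p (\<theta> 0) k)
      * \<tau> (side_of p k)
    + dg p * (\<Sum>i\<in>users p. dh p i * trace (Rb p ** (Lmat p (\<theta> 0) k i
        + chi1 p (\<theta> 0) k *\<^sub>M Cmat p (\<theta> 0) i)) * \<tau> (side_of p i))) (at 0)"
proof -
  let ?\<theta> = "\<theta> 0" and ?P = "Psi p (\<theta> 0) k" and ?S = "Psi_sum p (\<theta> 0)" and ?w = "side_of p k"
  let ?dS = "\<Sum>j\<in>users p. dPsi j"
  define u where "u = (\<Sum>j\<in>users p. pu p j * (var_si p k j + dh p k * dh_til p j * trA p ?\<theta> ?w))"
  define q where "q = complex_of_real (\<Sum>j\<in>users p. pu p j * dh_til p j)"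
  have dR: "((\<lambda>s. Rmat p (\<theta> s) k) has_vector_derivative
      (dg p * dh p k * \<tau> ?w) *\<^sub>M Rb p) (at 0)"
    unfolding Rmat_def by (intro has_vector_derivative_mscale_left has_vector_derivative_mult_right trA_deriv)
  have "((\<lambda>s. \<Sum>j\<in>users p. pu p j * (var_si p k j + dh p k * dh_til p j * trA p (\<theta> s) ?w))
      has_vector_derivative (\<Sum>j\<in>users p. pu p j * (0 + dh p k * dh_til p j * \<tau> ?w))) (at 0)"
    by (intro has_vector_derivative_sum has_vector_derivative_mult_right has_vector_derivative_add
        has_vector_derivative_const trA_deriv)
  then have du: "((\<lambda>s. \<Sum>j\<in>users p. pu p j * (var_si p k j + dh p k * dh_til p j * trA p (\<theta> s) ?w))
      has_vector_derivative dh p k * q * \<tau> ?w) (at 0)"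
    by (simp add: q_def sum_distrib_left sum_distrib_right mult_ac)
  \<comment> \<open>Grouped as the variations of \<open>Rmat\<close>, of \<open>Psi_sum\<close>, of
    the scalar sum \<open>u\<close> and of the subtracted square.\<close>
  have D: "((\<lambda>s. I_d p k (\<theta> s)) has_vector_derivative
      trace (?S ** ((dg p * dh p k * \<tau> ?w) *\<^sub>M Rb p))
      + (trace (Rmat p ?\<theta> k ** ?dS) + (trace ?dS / pb p * u + var_d p / pb p * trace ?dS))
      + trace ?S / pb p * (dh p k * q) * \<tau> ?w
      - (trace (?P ** dPsi k) + trace (?P ** dPsi k))) (at 0)"
    unfolding I_d_def
    by (rule has_vector_derivative_eq_rhs,
        (rule dR du Psi_deriv Psi_sum_deriv k has_vector_derivative_add has_vector_derivative_diff
          has_vector_derivative_mult_right has_vector_derivative_mult has_vector_derivative_divide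
          has_vector_derivative_trace_mult has_vector_derivative_trace)+)
      (simp add: u_def algebra_simps)
  have e1: "trace (?S ** ((dg p * dh p k * \<tau> ?w) *\<^sub>M Rb p)) =
      dg p * dh p k * \<tau> ?w * trace (Rb p ** ?S)"
    by (simp add: matrix_mult_mscale trace_mscale trace_mul_sym[of ?S])
  have e2: "trace (?P ** dPsi k) + trace (?P ** dPsi k) =
      dg p * dh p k * \<tau> ?w * trace (Rb p ** Bmat p ?\<theta> k)"
    by (simp add: trace_dPsi Bmat_def matrix_mult_mscale trace_mscale)
  have e3: "trace ?S / pb p * (dh p k * q) = chi2 p ?\<theta> k"
    by (simp add: chi2_def q_def)
  have e4: "trace (Rmat p ?\<theta> k ** ?dS) + chi1 p ?\<theta> k * trace ?dS =
      dg p * (\<Sum>i\<in>users p. dh p i * trace (Rb p ** (Lmat p ?\<theta> k i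
        + chi1 p ?\<theta> k *\<^sub>M Cmat p ?\<theta> i)) * \<tau> (side_of p i))"
  proof -
    have "trace (Rmat p ?\<theta> k ** dPsi i) + chi1 p ?\<theta> k * trace (dPsi i) =
        dg p * (dh p i * trace (Rb p ** (Lmat p ?\<theta> k i
        + chi1 p ?\<theta> k *\<^sub>M Cmat p ?\<theta> i)) * \<tau> (side_of p i))" for i
      unfolding trace_dPsi trace_dPsi_C Lmat_def[symmetric]
      by (simp add: matrix_add_ldistrib trace_add matrix_mult_mscale trace_mscale algebra_simps)
    then have "dg p * (\<Sum>i\<in>users p. dh p i * trace (Rb p ** (Lmat p ?\<theta> k i
        + chi1 p ?\<theta> k *\<^sub>M Cmat p ?\<theta> i)) * \<tau> (side_of p i)) =
        (\<Sum>i\<in>users p. trace (Rmat p ?\<theta> k ** dPsi i) + chi1 p ?\<theta> k * trace (dPsi i))"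
      by (simp add: sum_distrib_left)
    then show ?thesis
      by (simp add: bounded_bilinear.sum_right[OF bounded_bilinear_matrix_mult]
          linear_sum[OF bounded_linear.linear[OF bounded_linear_trace]] sum.distrib sum_distrib_left)
  qed
  \<comment> \<open>\<open>chi1\<close> collects the scalars that multiply the trace of
    \<open>Psi_sum\<close>.\<close>
  have e5: "trace ?dS / pb p * u + var_d p / pb p * trace ?dS = chi1 p ?\<theta> k * trace ?dS"
    by (simp add: chi1_def u_def algebra_simps)
  have e6: "trace (Rb p ** (?S - Bmat p ?\<theta> k)) = trace (Rb p ** ?S) - trace (Rb p ** Bmat p ?\<theta> k)"
    by (simp add: matrix_mult_diff_right trace_sub)
  show ?thesis
    by (rule has_vector_derivative_eq_rhs[OF D]) (simp only: e1 e2 e3 e4 e5 e6, simp add: algebra_simps)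
qed

end

subsection \<open>Wirtinger gradients\<close>

text \<open>\<open>c = 1\<close> and \<open>c = \<i>\<close> are the lines along which
  \<open>has_conj_gradient\<close> takes its partial derivatives.\<close>

definition coord_curve :: "(side \<Rightarrow> complex^'n) \<Rightarrow> side \<Rightarrow> 'n \<Rightarrow> complex \<Rightarrow> real \<Rightarrow> side \<Rightarrow> complex^'n" where
  "coord_curve \<theta> m n c s = \<theta>(m := \<theta> m + axis n (c * complex_of_real s))"

text \<open>Directional derivative of \<open>trA\<close> in Wirtinger form: the coefficient of
  \<open>cnj c\<close> is the derivative in the conjugate coordinate, that of \<open>c\<close> the
  derivative in the coordinate itself.\<close>

definition trA_coord_deriv ::
    "('t::finite, 'r::finite, 'n::finite) params \<Rightarrow> (side \<Rightarrow> complex^'n) \<Rightarrow> side \<Rightarrow> 'n \<Rightarrow> complex \<Rightarrow> complex" where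
  "trA_coord_deriv p \<theta> m n c =
     cnj c * avec p \<theta> m $ n + c * (\<Sum>i\<in>UNIV. Rs p $ i $ n * Rs p $ n $ i * cnj (\<theta> m $ i))"

lemma coord_curve_0: "coord_curve \<theta> m n c 0 = \<theta>"
  by (simp add: coord_curve_def axis_def fun_eq_iff vec_eq_iff)

text \<open>The product rule in each summand of \<open>trA_eq\<close> separates a conjugate-linear
  from a linear part in \<open>c\<close>; the trace of the other side does not contain the moving
  variable.\<close>

lemma trace_curve_coord_curve:
  assumes "valid_params p"
  shows "trace_curve p (coord_curve \<theta> m n c)
    (\<lambda>w. if w = m then trA_coord_deriv p \<theta> m n c else 0)"
proof
  show "((\<lambda>s. trA p (coord_curve \<theta> m n c s) w) has_vector_derivative
      (if w = m then trA_coord_deriv p \<theta> m n c else 0)) (at 0)" for w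
  proof (cases "w = m")
    case False
    then have "trA p (coord_curve \<theta> m n c s) w = trA p \<theta> w" for s
      by (simp add: trA_eq coord_curve_def)
    then show ?thesis using False by simp
  next
    case True
    let ?e = "\<lambda>j. if j = n then c else 0"
    have co: "coord_curve \<theta> m n c s w $ j = \<theta> m $ j + ?e j * of_real s" for s j
      using True by (simp add: coord_curve_def axis_def)
    have a: "((\<lambda>s. \<theta> m $ j + ?e j * of_real s) has_vector_derivative ?e j) (at 0)" for j
      using has_vector_derivative_mult_right[OF has_vector_derivative_of_real[OF DERIV_ident], of "?e j"]
      by (auto intro!: derivative_eq_intros)
    have b: "((\<lambda>s. cnj (\<theta> m $ j + ?e j * of_real s)) has_vector_derivative cnj (?e j)) (at 0)" for j
      by (rule bounded_linear.has_vector_derivative[OF bounded_linear_cnj a])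
    have av: "avec p \<theta> m $ n = (\<Sum>j\<in>UNIV. Rs p $ n $ j * Rs p $ j $ n * \<theta> m $ j)"
      by (simp add: avec_def vecd_def Amat_def matrix_matrix_mult_def diag_def if_distrib mult_ac
          cong: if_cong)
    have "((\<lambda>s. trA p (coord_curve \<theta> m n c s) w) has_vector_derivative
        (\<Sum>i\<in>UNIV. \<Sum>j\<in>UNIV. Rs p $ i $ j *
          (\<theta> m $ j * Rs p $ j $ i * cnj (?e i) + ?e j * Rs p $ j $ i * cnj (\<theta> m $ i)))) (at 0)"
      unfolding trA_eq co
      by (rule has_vector_derivative_eq_rhs,
          (rule a b has_vector_derivative_sum has_vector_derivative_mult_right
            has_vector_derivative_mult_left has_vector_derivative_mult)+)
        simp
    moreover have "(\<Sum>i\<in>UNIV. \<Sum>j\<in>UNIV. Rs p $ i $ j * (\<theta> m $ j * Rs p $ j $ i * cnj (?e i))) =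
        cnj c * avec p \<theta> m $ n"
      by (simp add: av if_distrib sum_distrib_left mult_ac cong: if_cong)
        (subst sum.swap, simp add: mult_ac)
    moreover have "(\<Sum>i\<in>UNIV. \<Sum>j\<in>UNIV. Rs p $ i $ j * (?e j * Rs p $ j $ i * cnj (\<theta> m $ i))) =
        c * (\<Sum>i\<in>UNIV. Rs p $ i $ n * Rs p $ n $ i * cnj (\<theta> m $ i))"
      by (simp add: if_distrib if_distribR sum_distrib_left mult_ac cong: if_cong)
    ultimately show ?thesis
      using True by (simp add: distrib_left sum.distrib trA_coord_deriv_def)
  qed
qed (rule assms)

text \<open>Combining the directions 1 and \<open>\<i>\<close> keeps the conjugate-linear part, as
  \<open>1 + \<i> * cnj \<i> = 2\<close>, and cancels the linear part, as
  \<open>1 + \<i> * \<i> = 0\<close>.\<close>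

lemma has_conj_gradient_if_coord_curve:
  assumes "\<And>n c. ((\<lambda>s. f (coord_curve \<theta> m n c s)) has_vector_derivative
    D * trA_coord_deriv p \<theta> m n c) (at 0)"
  shows "((\<lambda>z. f (\<theta>(m := z))) has_conj_gradient D *s avec p \<theta> m) (\<theta> m)"
  unfolding has_conj_gradient_def
proof (intro allI exI conjI)
  fix n
  show "((\<lambda>s. f (\<theta>(m := \<theta> m + axis n (complex_of_real s)))) has_vector_derivative
      D * trA_coord_deriv p \<theta> m n 1) (at 0)"
    using assms[of n 1] by (simp add: coord_curve_def)
  show "((\<lambda>s. f (\<theta>(m := \<theta> m + axis n (\<i> * complex_of_real s)))) has_vector_derivative
      D * trA_coord_deriv p \<theta> m n \<i>) (at 0)"
    using assms[of n \<i>] by (simp add: coord_curve_def)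
  show "(D *s avec p \<theta> m) $ n =
      (D * trA_coord_deriv p \<theta> m n 1 + \<i> * (D * trA_coord_deriv p \<theta> m n \<i>)) / 2"
    by (simp add: trA_coord_deriv_def algebra_simps)
qed

theorem theorem3:
  fixes p :: "('t::finite, 'r::finite, 'n::finite) params"
    and \<theta> :: "side \<Rightarrow> complex^'n"
    and k :: nat
  assumes "valid_params p"
    and "trace (Psi_sum p \<theta>) \<noteq> 0"
    and "k \<in> users p"
  shows
    "((\<lambda>z. S_u p k (\<theta>(Rside := z))) has_conj_gradient nu_til p \<theta> k *s avec p \<theta> Rside) (\<theta> Rside) \<and>
     ((\<lambda>z. S_u p k (\<theta>(Tside := z))) has_conj_gradient 0) (\<theta> Tside) \<and>

     ((\<lambda>z. S_d p k (\<theta>(Rside := z))) has_conj_gradient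
        (if side_of p k = Rside then nu p \<theta> k *s avec p \<theta> Rside else 0)) (\<theta> Rside) \<and>
     ((\<lambda>z. S_d p k (\<theta>(Tside := z))) has_conj_gradient
        (if side_of p k = Tside then nu p \<theta> k *s avec p \<theta> Tside else 0)) (\<theta> Tside) \<and>

     ((\<lambda>z. I_u p k (\<theta>(Rside := z))) has_conj_gradient
        (dg_til p * dh_til p k *
           trace (Rb_til p ** (B1_til p \<theta> k + B2_til p \<theta> k - B3_til p \<theta> k + var_b p *\<^sub>M C_til p \<theta> k))
         + dg_til p * (\<Sum>j\<in>users p. dh_til p j * pu p j) * trace (Rb_til p ** Psi_til p \<theta> k)
         + dg p * (\<Sum>i\<in>Kr p. dh p i * trace (Rb p ** L_til p \<theta> k i))
         + chi_til p \<theta> k) *s avec p \<theta> Rside) (\<theta> Rside) \<and>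
     ((\<lambda>z. I_u p k (\<theta>(Tside := z))) has_conj_gradient
        (dg p * (\<Sum>i\<in>Kt p. dh p i * trace (Rb p ** L_til p \<theta> k i))) *s avec p \<theta> Tside) (\<theta> Tside) \<and>

     (side_of p k = Rside \<longrightarrow>
       ((\<lambda>z. I_d p k (\<theta>(Rside := z))) has_conj_gradient
          (dg p * dh p k * trace (Rb p ** (Psi_sum p \<theta> - Bmat p \<theta> k))
           + dg p * (\<Sum>i\<in>Kr p. dh p i * trace (Rb p ** (Lmat p \<theta> k i + chi1 p \<theta> k *\<^sub>M Cmat p \<theta> i)))
           + chi2 p \<theta> k) *s avec p \<theta> Rside) (\<theta> Rside) \<and>
       ((\<lambda>z. I_d p k (\<theta>(Tside := z))) has_conj_gradient
          (dg p * (\<Sum>i\<in>Kt p. dh p i * trace (Rb p ** (Lmat p \<theta> k i + chi1 p \<theta> k *\<^sub>M Cmat p \<theta> i))))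
            *s avec p \<theta> Tside) (\<theta> Tside)) \<and>
     (side_of p k = Tside \<longrightarrow>
       ((\<lambda>z. I_d p k (\<theta>(Rside := z))) has_conj_gradient
          (dg p * (\<Sum>i\<in>Kr p. dh p i * trace (Rb p ** (Lmat p \<theta> k i + chi1 p \<theta> k *\<^sub>M Cmat p \<theta> i))))
            *s avec p \<theta> Rside) (\<theta> Rside) \<and>
       ((\<lambda>z. I_d p k (\<theta>(Tside := z))) has_conj_gradient
          (dg p * dh p k * trace (Rb p ** (Psi_sum p \<theta> - Bmat p \<theta> k))
           + dg p * (\<Sum>i\<in>Kt p. dh p i * trace (Rb p ** (Lmat p \<theta> k i + chi1 p \<theta> k *\<^sub>M Cmat p \<theta> i)))
           + chi2 p \<theta> k) *s avec p \<theta> Tside) (\<theta> Tside))"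
proof -
  have U: "users p = Kr p \<union> Kt p" "Kr p \<inter> Kt p = {}"
    using assms(1) by (auto simp: valid_params_def)
  have fin: "finite (users p)"
    by (simp add: users_def)
  \<comment> \<open>A velocity supported on one side collapses the sum over users.
    \<open>side_of\<close> is \<open>Tside\<close> off \<open>Kr\<close>, which among the users
    means exactly on \<open>Kt\<close>.\<close>
  have sumR: "(\<Sum>i\<in>users p. f i * (if side_of p i = Rside then x else 0)) = (\<Sum>i\<in>Kr p. f i) * x"
    and sumT: "(\<Sum>i\<in>users p. f i * (if side_of p i = Tside then x else 0)) = (\<Sum>i\<in>Kt p. f i) * x"
    for f :: "nat \<Rightarrow> complex" and x
    using U(2) fin unfolding U(1) sum_distrib_right
    by (auto intro!: sum.mono_neutral_cong_right simp: side_of_def split: if_splits)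
  have if_scale: "(if P then D *s v else 0) = (if P then D else 0) *s v" and zero: "0 = 0 *s v"
    for P and D :: complex and v :: "complex^'n"
    by simp_all
  have [simp]: "Tside \<noteq> Rside" by simp
  note curve = trace_curve_coord_curve[OF assms(1), of \<theta>]
  \<comment> \<open>What remains after this composition is an equation between the computed
    derivative and a coefficient times \<open>trA_coord_deriv\<close>.\<close>
  note grad = has_conj_gradient_if_coord_curve[OF has_vector_derivative_eq_rhs]
  note S_u = grad[OF trace_curve.S_u_deriv[OF curve assms(3)]]
    and S_d = grad[OF trace_curve.S_d_deriv[OF curve assms(3)]]
    and I_u = grad[OF trace_curve.I_u_deriv[OF curve assms(3), unfolded coord_curve_0, OF assms(2)]]
    and I_d = grad[OF trace_curve.I_d_deriv[OF curve assms(3)]]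
  show ?thesis
    unfolding if_scale
  proof (intro conjI impI)
    \<comment> \<open>A bare \<open>0\<close> does not match the rule, so it is written as
      \<open>0 *s v\<close> first; the coefficient vanishes because the \<open>Rside\<close> trace
      has velocity 0 along \<open>Tside\<close> lines.\<close>
    show "((\<lambda>z. S_u p k (\<theta>(Tside := z))) has_conj_gradient 0) (\<theta> Tside)"
      by (subst zero, rule S_u) (simp add: coord_curve_0)
  qed ((rule S_u S_d, simp add: coord_curve_0)
    | (rule I_u I_d, simp only: coord_curve_0 sumR sumT, simp add: algebra_simps))+
qed

end
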